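(* For every fixed $\varepsilon>0$ there exists $T_0=T_0(\varepsilon)$ such that for every real $T\ge T_0$ the function $x\mapsto \Delta_2(x)\Delta_3(x)$ changes sign in the interval $[T,\,T+T^{139/144+\varepsilon}]$.
   Context: For an integer $k\ge 2$ and $n\in\mathbb{N}$, $d_k(n)$ denotes the number of ways of writing $n$ as an ordered product of $k$ natural numbers, and $d_2(n)=d(n)$. For real $x\ge 1$, the error term $\Delta_k(x)$ in the $k$-fold divisor problem is defined by $$\sum_{n\le x} d_k(n) = M_k(x)+\Delta_k(x),\qquad M_k(x)=\operatorname{Res}_{s=1}\ \zeta^k(s)\,x^s s^{-1},$$ where $\zeta$ is the Riemann zeta function. In particular $M_2(x)=x\log x+(2\gamma-1)x$ with $\gamma$ Euler's constant. A real function "changes sign" in an interval if it takes both a strictly positive and a strictly negative value there. *)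

theory Defs
  imports "HOL-Complex_Analysis.Complex_Analysis"
begin

text \<open>
  The value at \<open>s\<close> of the holomorphic continuation of the Dirichlet series to a punctured half-plane
  containing \<open>s\<close>. The value at the pole \<open>s = 1\<close> is left unspecified; residues do not depend on it.
\<close>

definition zeta :: "complex \<Rightarrow> complex" where
  "zeta s = (THE z. \<exists>r f. r < Re s \<and> f holomorphic_on ({w. r < Re w} - {1}) \<and>
     (\<forall>w. Re w > 1 \<longrightarrow> (\<lambda>n. 1 / of_nat (Suc n) powr w) sums f w) \<and> z = f s)"

definition num_factorizations :: "nat \<Rightarrow> nat \<Rightarrow> nat" where
  "num_factorizations k n =
     card {ms :: nat list. length ms = k \<and> (\<forall>m\<in>set ms. m > 0) \<and> prod_list ms = n}"

text \<open>The residue is a real number (lemma \<open>residue_in_Reals\<close> below), so taking the real part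
  only changes the type.\<close>

definition divisor_main_term :: "nat \<Rightarrow> real \<Rightarrow> real" where
  "divisor_main_term k x = Re (residue (\<lambda>s. zeta s ^ k * of_real x powr s / s) 1)"

definition divisor_error :: "nat \<Rightarrow> real \<Rightarrow> real" where
  "divisor_error k x =
     (\<Sum>n\<in>{1..nat \<lfloor>x\<rfloor>}. real (num_factorizations k n)) - divisor_main_term k x"

definition changes_sign_on :: "(real \<Rightarrow> real) \<Rightarrow> real set \<Rightarrow> bool" where
  "changes_sign_on f S \<longleftrightarrow> (\<exists>x\<in>S. f x > 0) \<and> (\<exists>x\<in>S. f x < 0)"

lemma zeta_eqI:
  assumes "r < Re s" "s \<noteq> 1" "f holomorphic_on ({w. r < Re w} - {1})"
    and "\<And>w. Re w > 1 \<Longrightarrow> (\<lambda>n. 1 / of_nat (Suc n) powr w) sums f w"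
  shows "zeta s = f s"
  unfolding zeta_def
proof (rule the_equality)
  show "\<exists>r' f'. r' < Re s \<and> f' holomorphic_on ({w. r' < Re w} - {1}) \<and>
     (\<forall>w. Re w > 1 \<longrightarrow> (\<lambda>n. 1 / of_nat (Suc n) powr w) sums f' w) \<and> f s = f' s"
    using assms by blast
next
  fix z
  assume "\<exists>r f. r < Re s \<and> f holomorphic_on ({w. r < Re w} - {1}) \<and>
     (\<forall>w. Re w > 1 \<longrightarrow> (\<lambda>n. 1 / of_nat (Suc n) powr w) sums f w) \<and> z = f s"
  then obtain r' g where g: "r' < Re s" "g holomorphic_on ({w. r' < Re w} - {1})"
     "\<And>w. Re w > 1 \<Longrightarrow> (\<lambda>n. 1 / of_nat (Suc n) powr w) sums g w" "z = g s" by blast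
  define A where "A = {w. max r r' < Re w} - {1::complex}"
  define R where "R = max 1 (max r r') + 1"
  have opn: "open {w. max r r' < Re w}" by (rule open_halfspace_Re_gt)
  have A: "open A" unfolding A_def using opn by (rule open_delete)
  have conn: "connected A" unfolding A_def
    by (rule connected_open_delete[OF opn])
       (auto intro!: convex_connected convex_halfspace_Re_gt simp del: max_less_iff_conj)
  have opU: "open {w. max 1 (max r r') < Re w}" by (rule open_halfspace_Re_gt)
  have "(\<lambda>w. f w - g w) s = 0"
  proof (rule analytic_continuation_open[where s = "{w. max 1 (max r r') < Re w}" and s' = A
      and f = "\<lambda>w. f w - g w" and g = "\<lambda>_. 0"])
    show "{w. max 1 (max r r') < Re w} \<noteq> {}"
    proof -
      have "complex_of_real R \<in> {w. max 1 (max r r') < Re w}"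
        by (auto simp: R_def)
      then show ?thesis by blast
    qed
    show "f w - g w = 0" if "w \<in> {w. max 1 (max r r') < Re w}" for w
      using assms(4)[of w] g(3)[of w] that by (auto dest: sums_unique2)
    show "(\<lambda>w. f w - g w) holomorphic_on A"
      by (intro holomorphic_intros holomorphic_on_subset[OF assms(3)] holomorphic_on_subset[OF g(2)])
         (auto simp: A_def)
    show "s \<in> A" using assms g by (auto simp: A_def)
  qed (use opU A conn in \<open>auto simp: A_def\<close>)
  then show "z = f s" using g by simp
qed

lemma zeta_term_bound:
  fixes s :: complex and N :: nat
  assumes N: "N > 0" and s: "Re s > 0"
  defines "a \<equiv> of_nat N :: complex"
  shows "norm ((1 - s) * a powr (-s) - (a + 1) powr (1 - s) + a powr (1 - s))
           \<le> norm (1 - s) * norm s * real N powr (- Re s - 1)"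
proof -
  define S where "S = closed_segment a (a + 1)"
  have S: "\<exists>t. w = of_real t \<and> real N \<le> t \<and> t \<le> real N + 1" if w: "w \<in> S" for w
  proof -
    from w obtain u where u: "0 \<le> u" "u \<le> 1" "w = (1 - u) *\<^sub>R a + u *\<^sub>R (a + 1)"
      unfolding S_def closed_segment_def by auto
    have "w = of_real (real N + u)"
      by (simp add: u a_def scaleR_conv_of_real algebra_simps)
    with u show ?thesis by (intro exI[of _ "real N + u"]) auto
  qed
  have conv: "convex S" and endp: "a \<in> S" "a + 1 \<in> S" by (auto simp: S_def)
  have nn: "w \<notin> \<real>\<^sub>\<le>\<^sub>0" if "w \<in> S" for w
    using S[OF that] N by (auto simp: complex_nonpos_Reals_iff)
  have le1: "norm (w - a) \<le> 1" if "w \<in> S" for w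
  proof -
    from S[OF that] obtain t where t: "w = of_real t" "real N \<le> t" "t \<le> real N + 1" by blast
    have "w - a = of_real (t - real N)" by (simp add: t a_def)
    then have "norm (w - a) = \<bar>t - real N\<bar>" by (metis norm_of_real)
    with t show ?thesis by simp
  qed
  have 1: "norm (w powr (-s) - a powr (-s)) \<le> norm s * real N powr (- Re s - 1)" if w: "w \<in> S" for w
  proof -
    have "norm (w powr (-s) - a powr (-s)) \<le> (norm s * real N powr (- Re s - 1)) * norm (w - a)"
    proof (rule field_differentiable_bound[OF conv])
      fix z assume z: "z \<in> S"
      show "((\<lambda>z. z powr (-s)) has_field_derivative (- s) * z powr (-s - 1)) (at z within S)"
        using nn[OF z] by (auto intro!: derivative_eq_intros)
      from S[OF z] obtain t where t: "z = of_real t" "real N \<le> t" by blast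
      have "norm (z powr (-s - 1)) = t powr (- Re s - 1)"
        using t N by (simp add: norm_powr_real_powr)
      also have "\<dots> \<le> real N powr (- Re s - 1)"
        using t N s by (intro powr_mono2') auto
      finally show "norm ((- s) * z powr (-s - 1)) \<le> norm s * real N powr (- Re s - 1)"
        by (simp add: norm_mult mult_left_mono)
    qed (use w endp in auto)
    also have "\<dots> \<le> (norm s * real N powr (- Re s - 1)) * 1"
      by (intro mult_left_mono le1 w) auto
    finally show ?thesis by simp
  qed
  define \<psi> where "\<psi> = (\<lambda>w. (1 - s) * a powr (-s) * w - w powr (1 - s))"
  have "norm (\<psi> (a + 1) - \<psi> a) \<le> (norm (1 - s) * norm s * real N powr (- Re s - 1)) * norm (a + 1 - a)"
  proof (rule field_differentiable_bound[OF conv])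
    fix z assume z: "z \<in> S"
    show "(\<psi> has_field_derivative (1 - s) * (a powr (-s) - z powr (-s))) (at z within S)"
      unfolding \<psi>_def using nn[OF z] by (auto intro!: derivative_eq_intros simp: algebra_simps)
    show "norm ((1 - s) * (a powr (-s) - z powr (-s))) \<le> norm (1 - s) * norm s * real N powr (- Re s - 1)"
      using 1[OF z] by (simp add: norm_mult mult.assoc mult_left_mono norm_minus_commute)
  qed (use endp in auto)
  also have "\<psi> (a + 1) - \<psi> a = (1 - s) * a powr (-s) - (a + 1) powr (1 - s) + a powr (1 - s)"
    by (simp add: \<psi>_def algebra_simps)
  finally show ?thesis by simp
qed

lemma zeta_continuation:
  obtains F where "F holomorphic_on {s. Re s > 0}" "F 1 = 1"
    "(F has_field_derivative euler_mascheroni) (at 1)"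
    "\<And>s. Re s > 0 \<Longrightarrow> F (cnj s) = cnj (F s)"
    "\<And>s. Re s > 1 \<Longrightarrow> (\<lambda>n. 1 / of_nat (Suc n) powr s) sums (F s / (s - 1))"
proof -
  define h where "h = (\<lambda>n s. (1 - s) * of_nat (Suc n) powr (-s)
     - (of_nat (Suc n) + 1) powr (1 - s) + of_nat (Suc n) powr (1 - s) :: complex)"
  define h' where "h' = (\<lambda>n s. - (of_nat (Suc n) powr (-s)) - (1 - s) * (ln (of_nat (Suc n)) * of_nat (Suc n) powr (-s))
     + ln (of_nat (Suc n) + 1) * (of_nat (Suc n) + 1) powr (1 - s)
     - ln (of_nat (Suc n)) * of_nat (Suc n) powr (1 - s) :: complex)"
  define H where "H = {s. Re s > 0}"
  have opH: "open H" unfolding H_def by (rule open_halfspace_Re_gt)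
  have nz: "of_nat (Suc n) + 1 \<noteq> (0::complex)" for n
    by (metis of_nat_Suc of_nat_eq_0_iff nat.distinct(1) add.commute)
  have bound: "norm (h n s) \<le> norm (1 - s) * norm s * real (Suc n) powr (- Re s - 1)"
    if "Re s > 0" for n s
    unfolding h_def using zeta_term_bound[of "Suc n" s] that by simp
  have "\<exists>g g'. \<forall>x\<in>H. ((\<lambda>n. h n x) sums g x) \<and> ((\<lambda>n. h' n x) sums g' x) \<and>
          (g has_field_derivative g' x) (at x)"
  proof (rule series_and_derivative_comparison_local[OF opH])
    fix n x
    have pw: "((\<lambda>z. c powr u z) has_field_derivative Ln c * c powr u x * d) (at x)"
      if "c \<noteq> 0" "(u has_field_derivative d) (at x)" for c u d
      using DERIV_chain2[OF has_field_derivative_powr_right[OF that(1)] that(2)] .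
    show "(h n has_field_derivative h' n x) (at x)"
      unfolding h_def h'_def using nz[of n] of_nat_neq_0[of n, where 'a = complex]
      by (auto intro!: derivative_eq_intros pw simp: algebra_simps simp del: of_nat_Suc Ln_of_nat)
  next
    fix x assume x: "x \<in> H"
    define d where "d = Re x / 2"
    define C where "C = (1 + norm x + d) * (norm x + d)"
    have d: "d > 0" using x by (auto simp: d_def H_def)
    have "summable (\<lambda>n. real (Suc n) powr (- d - 1))"
      using d by (subst summable_Suc_iff) (auto simp: summable_real_powr_iff)
    then have sm: "summable (\<lambda>n. C * real (Suc n) powr (- d - 1))" by (rule summable_mult)
    have "norm (h n y) \<le> C * real (Suc n) powr (- d - 1)" if y: "y \<in> ball x d \<inter> H" for n y
    proof -
      have dist: "norm (x - y) < d" using y by (simp add: dist_norm)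
      have "\<bar>Re (x - y)\<bar> \<le> norm (x - y)" by (rule abs_Re_le_cmod)
      with dist have re: "Re y \<ge> d" unfolding d_def by simp
      have ny: "norm y \<le> norm x + d"
        using norm_triangle_ineq4[of x "x - y"] dist by simp
      have n1: "norm (1 - y) \<le> 1 + norm x + d"
        using norm_triangle_ineq4[of 1 y] ny by simp
      have "norm (h n y) \<le> norm (1 - y) * norm y * real (Suc n) powr (- Re y - 1)"
        using bound[of y n] re d by simp
      also have "\<dots> \<le> C * real (Suc n) powr (- d - 1)"
        unfolding C_def using re ny n1 d
        by (intro mult_mono powr_mono) auto
      finally show ?thesis .
    qed
    with d sm show "\<exists>d h'. 0 < d \<and> summable h' \<and> (\<forall>\<^sub>F n in sequentially. \<forall>y\<in>ball x d \<inter> H. norm (h n y) \<le> h' n)"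
      by (intro exI[of _ d] exI[of _ "\<lambda>n. C * real (Suc n) powr (- d - 1)"]) auto
  qed
  then obtain g g' where g: "\<And>x. x \<in> H \<Longrightarrow> (\<lambda>n. h n x) sums g x"
     "\<And>x. x \<in> H \<Longrightarrow> (\<lambda>n. h' n x) sums g' x"
     "\<And>x. x \<in> H \<Longrightarrow> (g has_field_derivative g' x) (at x)" by blast
  have one: "1 \<in> H" by (simp add: H_def)
  show ?thesis
  proof (rule that[of "\<lambda>s. 1 - g s"])
    show "(\<lambda>s. 1 - g s) holomorphic_on {s. Re s > 0}"
      using g(3) opH unfolding H_def[symmetric]
      by (intro holomorphic_intros) (auto simp: holomorphic_on_open)
    have "h n 1 = 0" for n unfolding h_def using nz[of n] by (simp del: of_nat_Suc)
    then have "(\<lambda>n. 0) sums g 1" using g(1)[OF one] by simp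
    then show "1 - g 1 = 1" by (metis diff_zero sums_unique2 sums_zero)
    have "h' n 1 = - (inverse (of_nat (n+1)) + of_real (ln (of_nat (n+1))) - of_real (ln (of_nat (n+2))))" for n
    proof -
      have 1: "ln (of_nat (Suc n) :: complex) = of_real (ln (of_nat (n + 1)))"
        by (metis Ln_of_nat Suc_eq_plus1 zero_less_Suc)
      have e: "of_nat (Suc n) + 1 = (of_nat (n + 2) :: complex)" by simp
      have 2: "ln (of_nat (Suc n) + 1 :: complex) = of_real (ln (of_nat (n + 2)))"
        unfolding e by (rule Ln_of_nat) simp
      show ?thesis unfolding h'_def 1 2 using nz[of n]
        by (simp add: powr_minus field_simps del: of_nat_Suc)
    qed
    then have "(\<lambda>n. - (inverse (of_nat (n+1)) + of_real (ln (of_nat (n+1))) - of_real (ln (of_nat (n+2))))) sums g' 1"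
      using g(2)[OF one] by simp
    then have "g' 1 = - euler_mascheroni"
      using sums_minus[OF euler_mascheroni_sum] sums_unique2 by blast
    then show "((\<lambda>s. 1 - g s) has_field_derivative euler_mascheroni) (at 1)"
      using g(3)[OF one] by (auto intro!: derivative_eq_intros)
    show "1 - g (cnj s) = cnj (1 - g s)" if s: "Re s > 0" for s
    proof -
      have cp: "cnj (of_nat (Suc m) powr w) = of_nat (Suc m) powr (cnj w)" for m w
        by (subst cnj_powr) (auto simp del: of_nat_Suc)
      have e: "of_nat (Suc n) + 1 = (of_nat (Suc (Suc n)) :: complex)" for n by simp
      have "h n (cnj s) = cnj (h n s)" for n
        unfolding h_def e by (simp add: cp del: of_nat_Suc)
      then have "(\<lambda>n. cnj (h n s)) sums g (cnj s)" using g(1)[of "cnj s"] s by (simp add: H_def)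
      moreover have "(\<lambda>n. cnj (h n s)) sums cnj (g s)"
        using g(1)[of s] s by (simp add: H_def sums_cnj)
      ultimately show ?thesis using sums_unique2 by fastforce
    qed
    show "(\<lambda>n. 1 / of_nat (Suc n) powr s) sums ((1 - g s) / (s - 1))" if s: "Re s > 1" for s
    proof -
      have s1: "s \<noteq> 1" using s by auto
      have "(\<lambda>n. norm (of_nat (Suc n) powr (1 - s) :: complex)) = (\<lambda>n. real (Suc n) powr (1 - Re s))"
        by (rule ext) (simp add: norm_powr_real_powr del: of_nat_Suc)
      moreover have "(\<lambda>n. real (Suc n) powr (1 - Re s)) \<longlonglongrightarrow> 0"
        using s by real_asymp
      ultimately have "(\<lambda>n. of_nat (Suc n) powr (1 - s) :: complex) \<longlonglongrightarrow> 0"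
        by (metis tendsto_norm_zero_iff)
      then have tel: "(\<lambda>n. of_nat (Suc n) powr (1 - s) - of_nat (Suc (Suc n)) powr (1 - s)) sums (1 - 0 :: complex)"
        using telescope_sums'[of "\<lambda>n. of_nat (Suc n) powr (1 - s) :: complex" 0] by simp
      have "(\<lambda>n. h n s - (of_nat (Suc n) powr (1 - s) - of_nat (Suc (Suc n)) powr (1 - s))) sums (g s - (1 - 0))"
        by (rule sums_diff[OF g(1) tel]) (use s in \<open>simp add: H_def\<close>)
      moreover have "h n s - (of_nat (Suc n) powr (1 - s) - of_nat (Suc (Suc n)) powr (1 - s)) =
          (1 - s) * (1 / of_nat (Suc n) powr s)" for n
      proof -
        have e: "of_nat (Suc n) + 1 = (of_nat (Suc (Suc n)) :: complex)" by simp
        show ?thesis unfolding h_def e by (simp add: powr_minus divide_inverse del: of_nat_Suc)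
      qed
      ultimately have "(\<lambda>n. (1 - s) * (1 / of_nat (Suc n) powr s)) sums (g s - 1)" by simp
      then have "(\<lambda>n. (1 - s) * (1 / of_nat (Suc n) powr s) / (1 - s)) sums ((g s - 1) / (1 - s))"
        by (rule sums_divide)
      moreover have "(g s - 1) / (1 - s) = (1 - g s) / (s - 1)"
        using s1 by (simp add: divide_simps) (simp add: algebra_simps)
      ultimately show ?thesis using s1 by simp
    qed
  qed
qed

lemma zeta_cases:
  obtains F where "F holomorphic_on {s. Re s > 0}" "F 1 = 1"
    "(F has_field_derivative euler_mascheroni) (at 1)"
    "\<And>s. Re s > 0 \<Longrightarrow> F (cnj s) = cnj (F s)"
    "\<And>s. Re s > 0 \<Longrightarrow> s \<noteq> 1 \<Longrightarrow> zeta s = F s / (s - 1)"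
proof -
  obtain F where F: "F holomorphic_on {s. Re s > 0}" "F 1 = 1"
    "(F has_field_derivative euler_mascheroni) (at 1)"
    "\<And>s. Re s > 0 \<Longrightarrow> F (cnj s) = cnj (F s)"
    "\<And>s. Re s > 1 \<Longrightarrow> (\<lambda>n. 1 / of_nat (Suc n) powr s) sums (F s / (s - 1))"
    by (rule zeta_continuation) blast
  have hol: "(\<lambda>s. F s / (s - 1)) holomorphic_on ({w. 0 < Re w} - {1})"
    by (intro holomorphic_intros holomorphic_on_subset[OF F(1)]) auto
  have "zeta s = F s / (s - 1)" if "Re s > 0" "s \<noteq> 1" for s
    using zeta_eqI[OF that hol F(5)] by simp
  with F that show thesis by blast
qed

theorem zeta_holomorphic: "zeta holomorphic_on ({s. Re s > 0} - {1})"
proof -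
  obtain F where F: "F holomorphic_on {s. Re s > 0}"
    "\<And>s. Re s > 0 \<Longrightarrow> s \<noteq> 1 \<Longrightarrow> zeta s = F s / (s - 1)" by (rule zeta_cases) blast
  have hol: "(\<lambda>s. F s / (s - 1)) holomorphic_on ({w. 0 < Re w} - {1})"
    by (intro holomorphic_intros holomorphic_on_subset[OF F(1)]) auto
  show ?thesis by (rule holomorphic_transform[OF hol]) (use F in auto)
qed

theorem zeta_sums:
  assumes "Re s > 1"
  shows "(\<lambda>n. 1 / of_nat (Suc n) powr s) sums zeta s"
proof -
  obtain F where F: "F holomorphic_on {s. Re s > 0}"
    "\<And>s. Re s > 1 \<Longrightarrow> (\<lambda>n. 1 / of_nat (Suc n) powr s) sums (F s / (s - 1))"
    by (rule zeta_continuation) blast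
  have hol: "(\<lambda>s. F s / (s - 1)) holomorphic_on ({w. 0 < Re w} - {1})"
    by (intro holomorphic_intros holomorphic_on_subset[OF F(1)]) auto
  have "zeta s = F s / (s - 1)"
    by (rule zeta_eqI[OF _ _ hol F(2)]) (use assms in auto)
  with F(2)[OF assms] show ?thesis by simp
qed

lemma residue_eq_higher_deriv:
  assumes x: "x > 0"
  obtains G where "G holomorphic_on {s. Re s > 0}" "G 1 = of_real x"
    "\<And>s. Re s > 0 \<Longrightarrow> G (cnj s) = cnj (G s)"
    "(G has_field_derivative of_real (x * ln x + (real k * euler_mascheroni - 1) * x)) (at 1)"
    "residue (\<lambda>s. zeta s ^ k * of_real x powr s / s) 1 =
       (if k = 0 then 0 else (deriv ^^ (k - 1)) G 1 / fact (k - 1))"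
proof -
  obtain F where F: "F holomorphic_on {s. Re s > 0}" "F 1 = 1"
    "(F has_field_derivative euler_mascheroni) (at 1)"
    "\<And>s. Re s > 0 \<Longrightarrow> F (cnj s) = cnj (F s)"
    "\<And>s. Re s > 0 \<Longrightarrow> s \<noteq> 1 \<Longrightarrow> zeta s = F s / (s - 1)" by (rule zeta_cases) blast
  define G where "G = (\<lambda>s. F s ^ k * of_real x powr s / s)"
  have opH: "open {s. Re s > 0}" by (rule open_halfspace_Re_gt)
  have hol: "G holomorphic_on {s. Re s > 0}"
    unfolding G_def using x by (intro holomorphic_intros F(1)) auto
  show thesis
  proof (rule that[of G])
    show "G holomorphic_on {s. Re s > 0}" by fact
    show "G 1 = of_real x" using x by (simp add: G_def F)
    show "G (cnj s) = cnj (G s)" if "Re s > 0" for s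
      using that x by (simp add: G_def F cnj_powr)
    show "(G has_field_derivative of_real (x * ln x + (real k * euler_mascheroni - 1) * x)) (at 1)"
      unfolding G_def using x
      by (auto intro!: derivative_eq_intros F(3) simp: F(2) Ln_of_real algebra_simps)
    have "residue (\<lambda>s. zeta s ^ k * of_real x powr s / s) 1 = residue (\<lambda>s. G s / (s - 1) ^ k) 1"
    proof (rule residue_cong)
      have "\<forall>\<^sub>F s in nhds 1. s \<in> {s. Re s > 0}"
        by (rule eventually_nhds_in_open[OF opH]) simp
      then have "\<forall>\<^sub>F s in at 1. s \<in> {s. Re s > 0} \<and> s \<noteq> 1"
        by (auto simp: eventually_at_filter elim: eventually_mono)
      then show "\<forall>\<^sub>F s in at 1. zeta s ^ k * of_real x powr s / s = G s / (s - 1) ^ k"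
        by eventually_elim (auto simp: F(5) G_def power_divide)
    qed simp
    also have "\<dots> = (if k = 0 then 0 else (deriv ^^ (k - 1)) G 1 / fact (k - 1))"
    proof (cases k)
      case 0
      then show ?thesis using residue_holo[OF opH _ hol, of 1] by simp
    next
      case (Suc m)
      then show ?thesis using residue_holomorphic_over_power[OF opH _ hol, of 1 m] by simp
    qed
    finally show "residue (\<lambda>s. zeta s ^ k * of_real x powr s / s) 1 =
       (if k = 0 then 0 else (deriv ^^ (k - 1)) G 1 / fact (k - 1))" .
  qed
qed

lemma higher_deriv_cnj:
  assumes "open A" "G holomorphic_on A" "\<And>s. s \<in> A \<Longrightarrow> cnj s \<in> A"
    "\<And>s. s \<in> A \<Longrightarrow> G (cnj s) = cnj (G s)" "s \<in> A"
  shows "(deriv ^^ n) G (cnj s) = cnj ((deriv ^^ n) G s)"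
  using assms(5)
proof (induction n arbitrary: s)
  case 0
  then show ?case using assms by simp
next
  case (Suc n)
  define D where "D = (deriv ^^ n) G"
  have hol: "D holomorphic_on A"
    unfolding D_def using assms by (intro holomorphic_higher_deriv) auto
  have d: "(D has_field_derivative deriv D s) (at s)"
    using hol assms(1) Suc.prems by (rule holomorphic_derivI)
  have "(cnj \<circ> D \<circ> cnj has_field_derivative cnj (deriv D s)) (at (cnj s))"
    using has_field_derivative_cnj_cnj[of D "deriv D s" "cnj s"] d by simp
  moreover have "\<forall>\<^sub>F w in nhds (cnj s). w \<in> A"
    using assms Suc.prems by (intro eventually_nhds_in_open) auto
  then have "\<forall>\<^sub>F w in nhds (cnj s). (cnj \<circ> D \<circ> cnj) w = D w"
    by eventually_elim (use Suc.IH assms(3) in \<open>simp add: D_def\<close>)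
  ultimately have "(D has_field_derivative cnj (deriv D s)) (at (cnj s))"
    using DERIV_cong_ev[of "cnj s" "cnj s" "cnj \<circ> D \<circ> cnj" D] by auto
  then have "deriv D (cnj s) = cnj (deriv D s)" by (rule DERIV_imp_deriv)
  then show ?case by (simp add: D_def)
qed

theorem residue_in_Reals:
  assumes "x > 0"
  shows "residue (\<lambda>s. zeta s ^ k * of_real x powr s / s) 1 \<in> \<real>"
proof -
  obtain G where G: "G holomorphic_on {s. Re s > 0}"
    "\<And>s. Re s > 0 \<Longrightarrow> G (cnj s) = cnj (G s)"
    "residue (\<lambda>s. zeta s ^ k * of_real x powr s / s) 1 =
       (if k = 0 then 0 else (deriv ^^ (k - 1)) G 1 / fact (k - 1))"
    by (rule residue_eq_higher_deriv[OF assms, of k]) blast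
  have "(deriv ^^ (k - 1)) G (cnj 1) = cnj ((deriv ^^ (k - 1)) G 1)"
    by (rule higher_deriv_cnj[OF open_halfspace_Re_gt G(1)]) (use G(2) in auto)
  then have "(deriv ^^ (k - 1)) G 1 \<in> \<real>" by (simp add: Reals_cnj_iff)
  then have "(deriv ^^ (k - 1)) G 1 / fact (k - 1) \<in> \<real>"
    by (intro Reals_divide) (auto simp: fact_in_Reals)
  with G(3) show ?thesis by simp
qed

theorem divisor_main_term_2:
  assumes "x > 0"
  shows "divisor_main_term 2 x = x * ln x + (2 * euler_mascheroni - 1) * x"
proof -
  obtain G where G:
    "(G has_field_derivative of_real (x * ln x + (real 2 * euler_mascheroni - 1) * x)) (at 1)"
    "residue (\<lambda>s. zeta s ^ 2 * of_real x powr s / s) 1 =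
       (if (2::nat) = 0 then 0 else (deriv ^^ (2 - 1)) G 1 / fact (2 - 1))"
    by (rule residue_eq_higher_deriv[OF assms, of 2]) blast
  have "residue (\<lambda>s. zeta s ^ 2 * of_real x powr s / s) 1 = deriv G 1"
    using G(2) by simp
  also have "\<dots> = of_real (x * ln x + (2 * euler_mascheroni - 1) * x)"
    using DERIV_imp_deriv[OF G(1)] by simp
  finally show ?thesis unfolding divisor_main_term_def by (simp only: Re_complex_of_real)
qed

end

theory Submission
  imports Defs
begin

text \<open>
  Between two consecutive integers \<open>\<Delta>\<^sub>k\<close> is an integer minus \<open>M\<^sub>k\<close>, and \<open>M\<^sub>k\<close> is continuous and, far out,
  increasing; at an integer \<open>\<Delta>\<^sub>k\<close> jumps upwards. So \<open>\<Delta>\<^sub>2\<close> can pass from positive to negative values only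
  by sliding through a zero \<open>t\<close> that lies between two integers, and there \<open>M\<^sub>2(t)\<close> is an integer. If
  \<open>\<Delta>\<^sub>3(t) \<noteq> 0\<close>, then \<open>\<Delta>\<^sub>3\<close> keeps its sign near \<open>t\<close> and \<open>\<Delta>\<^sub>2\<Delta>\<^sub>3\<close> takes both signs. If \<open>\<Delta>\<^sub>3(t) = 0\<close>, then
  both factors decrease through zero, so \<open>\<Delta>\<^sub>2\<Delta>\<^sub>3\<close> is positive on both sides of \<open>t\<close>, but then \<open>M\<^sub>3(t)\<close> is an
  integer too. Hence one downward zero of \<open>\<Delta>\<^sub>2\<close> in an interval makes the product positive somewhere, and
  the product is also negative somewhere unless \<^emph>\<open>every\<close> downward zero \<open>t\<close> of \<open>\<Delta>\<^sub>2\<close> in the interval has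
  \<open>M\<^sub>2(t)\<close> and \<open>M\<^sub>3(t)\<close> both integral (\<open>sign_change_at_crossing\<close>). The theorem follows from two
  facts about the interval \<open>[T, T + T\<^sup>9\<^sup>/\<^sup>1\<^sup>0]\<close>, which is shorter than the one in the theorem.

  First, the number of downward zeros of \<open>\<Delta>\<^sub>2\<close> in it exceeds any given bound once \<open>T\<close> is large
  (\<open>many_downward_crossings\<close>), because \<open>\<Delta>\<^sub>2\<close> changes sign in every interval
  \<open>[N, N + 4N\<^sup>3\<^sup>/\<^sup>4]\<close> with \<open>N\<close> large. Indeed Dirichlet's hyperbola method writes \<open>\<Delta>\<^sub>2(n)\<close> as
  \<open>(log n)/2 + O(1)\<close> plus sawtooth functions of periods at most about \<open>\<surd>n\<close> and mean zero over a period.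
  Averaged twice over windows of length \<open>h \<ge> N\<^sup>3\<^sup>/\<^sup>4\<close>, a sawtooth of period \<open>a\<close> contributes
  \<open>O(a\<^sup>2/h\<^sup>2)\<close>, and the sum of this over \<open>a\<close> up to about \<open>\<surd>N\<close> is \<open>O(1)\<close>. So the average of \<open>\<Delta>\<^sub>2(n)\<close> is
  \<open>(log N)/2 + O(1)\<close>. This is positive; and it is smaller than \<open>log N\<close>, whereas \<open>\<Delta>\<^sub>2\<close> loses at least \<open>log N\<close>
  between \<open>n\<close> and \<open>n + 1\<close>, so \<open>\<Delta>\<^sub>2\<close> must be negative just before some integer.

  Secondly, the number of points \<open>t\<close> in it with \<open>M\<^sub>2(t)\<close> and \<open>M\<^sub>3(t)\<close> both integral is bounded
  independently of \<open>T\<close> (\<open>common_integer_values_bounded\<close>). The pigeonhole principle supplies a nonzero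
  integer polynomial \<open>P\<close> of fixed degree such that all low Taylor coefficients of
  \<open>F(x) = P(M\<^sub>2(x), M\<^sub>3(x))\<close> at \<open>T\<close> are tiny; as the functions involved vary on the scale \<open>T\<close>, much
  larger than \<open>T\<^sup>9\<^sup>/\<^sup>1\<^sup>0\<close>, this forces \<open>|F| < 1\<close> on the interval. At the points in question \<open>F\<close> is an
  integer, hence zero. But in the variable \<open>log x\<close> the function \<open>F\<close> is a nonzero exponential
  polynomial, and the number of its real zeros is bounded in terms of its degrees alone.
\<close>

section \<open>Zeros of exponential polynomials\<close>

text \<open>
  Rolle's theorem, used between neighbouring zeros.
\<close>

lemma derivative_zeros_between:
  fixes f f' :: "real \<Rightarrow> real"
  assumes "finite Z" and der: "\<And>x. (f has_real_derivative f' x) (at x)"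
    and zero: "\<And>x. x \<in> Z \<Longrightarrow> f x = 0"
  obtains Z' where "finite Z'" "card Z \<le> Suc (card Z')" "\<And>x. x \<in> Z' \<Longrightarrow> f' x = 0"
proof -
  have "\<exists>Z'. finite Z' \<and> card Z \<le> Suc (card Z') \<and> (\<forall>x\<in>Z'. f' x = 0 \<and> (\<exists>z\<in>Z. x < z))"
    using assms(1) zero
  proof (induction Z rule: finite_linorder_max_induct)
    case empty
    show ?case by (intro exI[of _ "{}"]) auto
  next
    case (insert b A)
    then obtain Z' where Z': "finite Z'" "card A \<le> Suc (card Z')"
      "\<And>x. x \<in> Z' \<Longrightarrow> f' x = 0" "\<And>x. x \<in> Z' \<Longrightarrow> \<exists>z\<in>A. x < z"
      by (auto simp: Ball_def)
    show ?case
    proof (cases "A = {}")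
      case True
      then show ?thesis by (intro exI[of _ "{}"]) auto
    next
      case False
      define a where "a = Max A"
      have a: "a \<in> A" "\<And>x. x \<in> A \<Longrightarrow> x \<le> a"
        using False insert.hyps by (auto simp: a_def)
      have "\<exists>z. a < z \<and> z < b \<and> DERIV f z :> 0"
      proof (rule Rolle)
        show "a < b" using a insert.hyps by auto
        show "f a = f b" using a insert.prems by auto
        show "continuous_on {a..b} f"
          by (intro continuous_at_imp_continuous_on ballI DERIV_isCont[OF der])
      qed (use der in \<open>auto simp: real_differentiable_def\<close>)
      then obtain z where z: "a < z" "z < b" "DERIV f z :> 0" by blast
      have "f' z = 0" using DERIV_unique[OF der z(3)] .
      moreover have "z \<notin> Z'" using Z'(4)[of z] a(2) z(1) by force
      moreover have "b \<notin> A" using insert.hyps by auto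
      ultimately show ?thesis
        using Z' z insert.hyps by (intro exI[of _ "insert z Z'"]) auto
    qed
  qed
  then show ?thesis using that by blast
qed

lemma smult_add_pderiv_eq_0:
  fixes p :: "real poly"
  assumes "smult c p + pderiv p = 0" "c \<noteq> 0"
  shows "p = 0"
proof (rule ccontr)
  assume "p \<noteq> 0"
  have "coeff (smult c p + pderiv p) (degree p) = c * lead_coeff p"
    by (simp add: coeff_pderiv coeff_eq_0)
  with assms \<open>p \<noteq> 0\<close> show False by simp
qed

text \<open>
  An exponential polynomial with as many zeros as it has coefficients vanishes identically. For any
  \<open>d\<close> in \<open>S\<close> the operator \<open>G \<mapsto> G' - d G\<close>, which is differentiation of \<open>exp (-d t) G(t)\<close>, loses at most one
  zero by Rolle, lowers the degree of the \<open>d\<close>-th coefficient by one and preserves the other degrees,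
  which gives an induction on the number of coefficients.
\<close>

lemma exponential_polynomial_eq_0:
  fixes R :: "nat \<Rightarrow> real poly" and n :: "nat \<Rightarrow> nat"
  assumes "finite S" "\<And>e i. e \<in> S \<Longrightarrow> n e \<le> i \<Longrightarrow> coeff (R e) i = 0"
    "finite Z" "sum n S \<le> card Z"
    "\<And>t. t \<in> Z \<Longrightarrow> (\<Sum>e\<in>S. exp (real e * t) * poly (R e) t) = 0"
    "e \<in> S"
  shows "R e = 0"
  using assms(2-)
proof (induction "sum n S" arbitrary: n R Z e)
  case 0
  then have "n e = 0" using assms(1) by (metis sum_eq_0_iff)
  then show ?case using 0 by (simp add: poly_eq_iff)
next
  case (Suc N)
  obtain d where d: "d \<in> S" "n d > 0"
    using Suc.hyps(2) by (metis bot_nat_0.not_eq_extremum nat.distinct(1) sum.neutral)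
  define G where "G = (\<lambda>t. \<Sum>e\<in>S. exp (real e * t) * poly (R e) t)"
  define R' where "R' = (\<lambda>e. smult (real e - real d) (R e) + pderiv (R e))"
  define G' where "G' = (\<lambda>t. \<Sum>e\<in>S. exp (real e * t) * poly (R' e) t)"
  define n' where "n' = n(d := n d - 1)"
  have der: "((\<lambda>t. exp (- real d * t) * G t) has_real_derivative exp (- real d * t) * G' t) (at t)" for t
  proof -
    have "((\<lambda>t. exp (- real d * t) * G t) has_real_derivative
       exp (- real d * t) * (\<Sum>e\<in>S. exp (real e * t) * (real e * poly (R e) t + poly (pderiv (R e)) t))
         + exp (- real d * t) * (- real d) * G t) (at t)"
      unfolding G_def
      by (auto intro!: derivative_eq_intros sum.cong simp: algebra_simps)
    also have "exp (- real d * t) * (\<Sum>e\<in>S. exp (real e * t) * (real e * poly (R e) t + poly (pderiv (R e)) t))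
         + exp (- real d * t) * (- real d) * G t = exp (- real d * t) * G' t"
      unfolding G_def G'_def R'_def
      by (simp add: sum_distrib_left flip: sum.distrib) (auto intro!: sum.cong simp: algebra_simps)
    finally show ?thesis .
  qed
  obtain Z' where Z': "finite Z'" "card Z \<le> Suc (card Z')"
      "\<And>t. t \<in> Z' \<Longrightarrow> exp (- real d * t) * G' t = 0"
    by (rule derivative_zeros_between[OF Suc.prems(2) der]) (use Suc.prems(4) in \<open>auto simp: G_def\<close>)
  have sn: "sum n S = Suc (sum n' S)"
    unfolding n'_def using d assms(1) by (simp add: sum.remove[of S d])
  have R'0: "R' e = 0" if "e \<in> S" for e
  proof (rule Suc.hyps(1)[of n' R' Z' e])
    show "N = sum n' S" using sn Suc.hyps(2) by simp
    show "coeff (R' e) i = 0" if "e \<in> S" "n' e \<le> i" for e i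
      using that Suc.prems(1)[of e i] Suc.prems(1)[of e "Suc i"] d
      by (auto simp: R'_def n'_def coeff_pderiv split: if_splits)
    show "sum n' S \<le> card Z'" using sn Z'(2) Suc.prems(3) by linarith
    show "(\<Sum>e\<in>S. exp (real e * t) * poly (R' e) t) = 0" if "t \<in> Z'" for t
      using Z'(3)[OF that] by (simp add: G'_def)
  qed (use Z' that in auto)
  have R0: "R f = 0" if "f \<in> S" "f \<noteq> d" for f
    using R'0[OF that(1)] that(2) smult_add_pderiv_eq_0[of "real f - real d" "R f"]
    by (auto simp: R'_def)
  have "pderiv (R d) = 0" using R'0[OF d(1)] by (simp add: R'_def)
  then obtain c where c: "R d = [:c:]" by (metis pderiv_eq_0_iff degree_0_id)
  have "Z \<noteq> {}" using Suc.prems(3) Suc.hyps(2) by auto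
  then obtain t where "t \<in> Z" by blast
  have "0 = G t" using Suc.prems(4)[OF \<open>t \<in> Z\<close>] by (simp add: G_def)
  also have "\<dots> = exp (real d * t) * c"
    unfolding G_def using d assms(1) R0 c by (subst sum.remove[of S d]) auto
  finally have "R d = 0" using c by simp
  with R0 show ?case using Suc.prems(5) by (cases "e = d") auto
qed


section \<open>Common integer values of the main terms\<close>

text \<open>
  Dirichlet's box principle: among the \<open>A ^ card K\<close> vectors with entries below \<open>A\<close>, two give the same
  integer parts to all \<open>J\<close> linear forms; take their difference.
\<close>

lemma small_integer_combination:
  fixes a :: "'i \<Rightarrow> nat \<Rightarrow> real" and A L J :: nat
  assumes "finite K" and bd: "\<And>i r. i \<in> K \<Longrightarrow> r < J \<Longrightarrow> \<bar>a i r\<bar> \<le> M"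
    and L: "real (card K) * real A * M \<le> real L"
    and less: "(2 * L + 1) ^ J < A ^ card K"
  obtains q :: "'i \<Rightarrow> int" where "\<exists>i\<in>K. q i \<noteq> 0" "\<And>i. i \<in> K \<Longrightarrow> \<bar>q i\<bar> \<le> int A"
    "\<And>r. r < J \<Longrightarrow> \<bar>\<Sum>i\<in>K. of_int (q i) * a i r\<bar> < 1"
proof -
  define P where "P = (K \<rightarrow>\<^sub>E {0..<A})"
  define c where "c = (\<lambda>p :: 'i \<Rightarrow> nat. \<lambda>r. \<Sum>i\<in>K. real (p i) * a i r)"
  define \<Phi> where "\<Phi> = (\<lambda>p. \<lambda>r\<in>{..<J}. \<lfloor>c p r\<rfloor>)"
  have cP: "card P = A ^ card K" and fP: "finite P"
    unfolding P_def using assms(1) by (auto simp: card_PiE finite_PiE)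
  have "\<Phi> p \<in> ({..<J} \<rightarrow>\<^sub>E {- int L..int L})" if p: "p \<in> P" for p
  proof -
    have "- int L \<le> \<lfloor>c p r\<rfloor> \<and> \<lfloor>c p r\<rfloor> \<le> int L" if r: "r < J" for r
    proof -
      have "\<bar>c p r\<bar> \<le> (\<Sum>i\<in>K. \<bar>real (p i) * a i r\<bar>)" unfolding c_def by (rule sum_abs)
      also have "\<dots> \<le> (\<Sum>i\<in>K. real A * M)"
      proof (rule sum_mono)
        fix i assume i: "i \<in> K"
        have "real (p i) \<le> real A" using p i unfolding P_def PiE_iff by fastforce
        then have "real (p i) * \<bar>a i r\<bar> \<le> real A * M"
          by (intro mult_mono bd[OF i r]) auto
        then show "\<bar>real (p i) * a i r\<bar> \<le> real A * M" by (simp add: abs_mult)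
      qed
      also have "\<dots> \<le> real L" using L by simp
      finally show ?thesis by linarith
    qed
    then show ?thesis by (auto simp: \<Phi>_def)
  qed
  then have "\<Phi> ` P \<subseteq> ({..<J} \<rightarrow>\<^sub>E {- int L..int L})" by blast
  then have "card (\<Phi> ` P) \<le> card ({..<J} \<rightarrow>\<^sub>E {- int L..int L})"
    by (intro card_mono finite_PiE) auto
  also have "\<dots> = (2 * L + 1) ^ J" by (simp add: card_PiE nat_add_distrib nat_mult_distrib)
  also have "\<dots> < card P" using less cP by simp
  finally have "\<not> inj_on \<Phi> P" using pigeonhole by blast
  then obtain p p' where pp: "p \<in> P" "p' \<in> P" "p \<noteq> p'" "\<Phi> p = \<Phi> p'" by (auto simp: inj_on_def)
  show ?thesis
  proof (rule that[of "\<lambda>i. int (p i) - int (p' i)"])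
    show "\<exists>i\<in>K. int (p i) - int (p' i) \<noteq> 0"
    proof (rule ccontr)
      assume "\<not> ?thesis"
      then have "p i = p' i" if "i \<in> K" for i using that by auto
      then have "p = p'" using pp(1,2) unfolding P_def by (intro PiE_ext[of p K _ p']) auto
      with pp(3) show False by simp
    qed
    show "\<bar>int (p i) - int (p' i)\<bar> \<le> int A" if "i \<in> K" for i
    proof -
      have "p i < A" "p' i < A" using pp that by (auto simp: P_def)
      then show ?thesis by linarith
    qed
    show "\<bar>\<Sum>i\<in>K. of_int (int (p i) - int (p' i)) * a i r\<bar> < 1" if "r < J" for r
    proof -
      have "\<lfloor>c p r\<rfloor> = \<lfloor>c p' r\<rfloor>" using fun_cong[OF pp(4), of r] that by (simp add: \<Phi>_def)
      then have "\<bar>c p r - c p' r\<bar> < 1" by linarith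
      then show ?thesis by (simp add: c_def algebra_simps sum_subtractf)
    qed
  qed
qed

text \<open>
  Cauchy's estimates for the coefficients, and for the tail a geometric series, since \<open>x\<close> lies in
  the disc of half the radius. Real parts of the coefficients suffice, as \<open>f\<close> is real on the real axis.
\<close>

lemma taylor_polynomial_bound:
  fixes f :: "complex \<Rightarrow> complex" and g :: "real \<Rightarrow> real"
  assumes hol: "f holomorphic_on cball (of_real T) R" and R: "R > 0"
    and bd: "\<And>z. z \<in> cball (of_real T) R \<Longrightarrow> norm (f z) \<le> B"
    and real: "\<And>x. \<bar>x - T\<bar> \<le> R \<Longrightarrow> f (of_real x) = of_real (g x)"
  obtains a :: "nat \<Rightarrow> real" where "\<And>r. \<bar>a r\<bar> \<le> B / R ^ r"
    "\<And>x J. \<bar>x - T\<bar> \<le> R / 2 \<Longrightarrow> \<bar>g x - (\<Sum>r<J. a r * (x - T) ^ r)\<bar> \<le> 2 * B * (\<bar>x - T\<bar> / R) ^ J"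
proof -
  define b where "b = (\<lambda>r. (deriv ^^ r) f (of_real T) / fact r)"
  have hol': "f holomorphic_on ball (of_real T) R"
    using hol by (rule holomorphic_on_subset) auto
  have nb: "norm (b r) \<le> B / R ^ r" for r
  proof -
    have "norm ((deriv ^^ r) f (of_real T)) \<le> fact r * B / R ^ r"
      by (rule Cauchy_inequality[OF hol' holomorphic_on_imp_continuous_on[OF hol] R])
         (use bd in \<open>auto simp: dist_norm norm_minus_commute\<close>)
    then have "norm ((deriv ^^ r) f (of_real T)) / fact r \<le> (fact r * B / R ^ r) / fact r"
      by (rule divide_right_mono) simp
    then show ?thesis by (simp add: b_def norm_divide)
  qed
  have "norm (f (of_real T)) \<le> B" using bd R by simp
  then have B: "B \<ge> 0" by (rule order_trans[OF norm_ge_zero])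
  show ?thesis
  proof (rule that[of "\<lambda>r. Re (b r)"])
    show "\<bar>Re (b r)\<bar> \<le> B / R ^ r" for r using nb[of r] abs_Re_le_cmod[of "b r"] by linarith
    fix x :: real and J :: nat
    assume x: "\<bar>x - T\<bar> \<le> R / 2"
    define y where "y = \<bar>x - T\<bar> / R"
    have y: "0 \<le> y" "y \<le> 1 / 2" using x R by (auto simp: y_def divide_simps)
    have "(\<lambda>r. b r * (of_real x - of_real T) ^ r) sums f (of_real x)"
      unfolding b_def
    proof (rule holomorphic_power_series[OF hol'])
      have "dist (complex_of_real T) (of_real x) = \<bar>T - x\<bar>" by (simp add: dist_of_real dist_real_def)
      also have "\<dots> < R" using x R by linarith
      finally show "complex_of_real x \<in> ball (of_real T) R" by simp
    qed
    then have "(\<lambda>r. Re (b r * (of_real x - of_real T) ^ r)) sums Re (f (of_real x))" by (rule sums_Re)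
    moreover have "Re (b r * (of_real x - of_real T) ^ r) = Re (b r) * (x - T) ^ r" for r
      by (simp flip: of_real_diff of_real_power)
    moreover have "f (of_real x) = of_real (g x)" using real[of x] x R by auto
    ultimately have s: "(\<lambda>r. Re (b r) * (x - T) ^ r) sums g x" by simp
    then have s1: "(\<lambda>r. Re (b (r + J)) * (x - T) ^ (r + J)) sums (g x - (\<Sum>r<J. Re (b r) * (x - T) ^ r))"
      by (rule sums_split_initial_segment)
    have s2: "(\<lambda>r. B * y ^ J * (1 / 2) ^ r) sums (B * y ^ J * 2)"
      using sums_mult[OF geometric_sums[of "1 / 2 :: real"], of "B * y ^ J"] by simp
    have le: "norm (Re (b (r + J)) * (x - T) ^ (r + J)) \<le> B * y ^ J * (1 / 2) ^ r" for r
    proof -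
      have "\<bar>Re (b (r + J))\<bar> \<le> B / R ^ (r + J)"
        using nb[of "r + J"] abs_Re_le_cmod[of "b (r + J)"] by linarith
      then have "\<bar>Re (b (r + J))\<bar> * \<bar>x - T\<bar> ^ (r + J) \<le> B / R ^ (r + J) * \<bar>x - T\<bar> ^ (r + J)"
        by (rule mult_right_mono) simp
      then have "norm (Re (b (r + J)) * (x - T) ^ (r + J)) \<le> B / R ^ (r + J) * \<bar>x - T\<bar> ^ (r + J)"
        by (simp add: abs_mult power_abs)
      also have "\<dots> = B * y ^ J * y ^ r" by (simp add: y_def power_divide power_add mult_ac)
      also have "\<dots> \<le> B * y ^ J * (1 / 2) ^ r" using y B by (intro mult_left_mono power_mono) auto
      finally show ?thesis .
    qed
    have "norm (g x - (\<Sum>r<J. Re (b r) * (x - T) ^ r)) \<le> B * y ^ J * 2"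
      using norm_sums_le[OF s1 s2 le] .
    then show "\<bar>g x - (\<Sum>r<J. Re (b r) * (x - T) ^ r)\<bar> \<le> 2 * B * (\<bar>x - T\<bar> / R) ^ J"
      by (simp add: y_def mult_ac)
  qed
qed

text \<open>
  The products \<open>P ^ i * Q ^ j\<close> with \<open>i + j\<close> fixed have different degrees \<open>i + 2 * j\<close>, so the term with
  the largest \<open>j\<close> cannot be cancelled.
\<close>

lemma sum_powers_degree_1_2_neq_0:
  fixes P Q :: "real poly" and q :: "nat \<times> nat \<Rightarrow> int"
  assumes P: "degree P = 1" and Q: "degree Q = 2" and K: "K \<subseteq> {..<m} \<times> {..<m}"
    and nz: "(i0, j0) \<in> K" "q (i0, j0) \<noteq> 0"
  shows "(\<Sum>(i, j)\<in>{(i, j) \<in> K. i + j = i0 + j0}. smult (of_int (q (i, j))) (P ^ i * Q ^ j)) \<noteq> 0"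
proof
  define e where "e = i0 + j0"
  define I where "I = {(i, j) \<in> K. i + j = e}"
  define J where "J = {j. \<exists>i. (i, j) \<in> I \<and> q (i, j) \<noteq> 0}"
  have fK: "finite K" using K by (rule finite_subset) auto
  then have fI: "finite I" unfolding I_def by (rule rev_finite_subset) auto
  have "J \<subseteq> snd ` I" by (force simp: J_def)
  then have fJ: "finite J" using fI by (rule finite_subset[OF _ finite_imageI])
  have "j0 \<in> J" using nz by (auto simp: J_def I_def e_def)
  define j1 where "j1 = Max J"
  have "j1 \<in> J" unfolding j1_def using fJ \<open>j0 \<in> J\<close> by (intro Max_in) auto
  then obtain i1 where i1: "(i1, j1) \<in> I" "q (i1, j1) \<noteq> 0" by (auto simp: J_def)
  have max: "j \<le> j1" if "(i, j) \<in> I" "q (i, j) \<noteq> 0" for i j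
    unfolding j1_def using fJ that by (intro Max_ge) (auto simp: J_def)
  have deg: "degree (P ^ i * Q ^ j) = i + 2 * j" for i j
  proof -
    have "P \<noteq> 0" "Q \<noteq> 0" using P Q by auto
    then show ?thesis using P Q by (simp add: degree_mult_eq degree_power_eq)
  qed
  have "coeff (\<Sum>(i, j)\<in>I. smult (of_int (q (i, j))) (P ^ i * Q ^ j)) (i1 + 2 * j1)
      = (\<Sum>(i, j)\<in>I. of_int (q (i, j)) * coeff (P ^ i * Q ^ j) (i1 + 2 * j1))"
    by (simp add: coeff_sum case_prod_unfold)
  also have "\<dots> = (\<Sum>(i, j)\<in>{(i1, j1)}. of_int (q (i, j)) * coeff (P ^ i * Q ^ j) (i1 + 2 * j1))"
  proof (rule sum.mono_neutral_right[OF fI])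
    show "\<forall>k\<in>I - {(i1, j1)}. (case k of (i, j) \<Rightarrow> of_int (q (i, j)) * coeff (P ^ i * Q ^ j) (i1 + 2 * j1)) = 0"
    proof
      fix k assume k: "k \<in> I - {(i1, j1)}"
      obtain i j where [simp]: "k = (i, j)" by (cases k)
      show "(case k of (i, j) \<Rightarrow> of_int (q (i, j)) * coeff (P ^ i * Q ^ j) (i1 + 2 * j1)) = 0"
      proof (cases "q (i, j) = 0")
        case False
        then have "j \<le> j1" using max k by auto
        moreover have "i + j = i1 + j1" using k i1 by (simp add: I_def)
        ultimately have "i + 2 * j < i1 + 2 * j1" using k by (cases "j = j1") auto
        then show ?thesis using deg[of i j] by (simp add: coeff_eq_0)
      qed simp
    qed
  qed (use i1 in auto)
  also have "\<dots> = of_int (q (i1, j1)) * lead_coeff (P ^ i1 * Q ^ j1)" by (simp add: deg)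
  also have "\<dots> \<noteq> 0" using i1 P Q by auto
  finally have "(\<Sum>(i, j)\<in>I. smult (of_int (q (i, j))) (P ^ i * Q ^ j)) \<noteq> 0" by auto
  moreover assume "(\<Sum>(i, j)\<in>{(i, j) \<in> K. i + j = i0 + j0}. smult (of_int (q (i, j))) (P ^ i * Q ^ j)) = 0"
  ultimately show False by (simp add: I_def e_def)
qed

text \<open>
  Sorting by \<open>e = i + j\<close> turns the sum into \<open>\<Sum> x ^ e * R\<^sub>e (ln x)\<close> with \<open>e < 2 * m\<close> and
  \<open>degree R\<^sub>e < 3 * m\<close>: an exponential polynomial in \<open>ln x\<close> with \<open>6 * m\<^sup>2\<close> coefficients.
\<close>

lemma common_zeros_card_less:
  fixes P Q :: "real poly" and q :: "nat \<times> nat \<Rightarrow> int"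
  assumes P: "degree P = 1" and Q: "degree Q = 2"
    and nz: "\<exists>k\<in>{..<m} \<times> {..<m}. q k \<noteq> 0"
    and S: "finite S" "\<And>x. x \<in> S \<Longrightarrow> x > 0"
      "\<And>x. x \<in> S \<Longrightarrow> (\<Sum>(i, j)\<in>{..<m} \<times> {..<m}. of_int (q (i, j)) * ((x * poly P (ln x)) ^ i * (x * poly Q (ln x)) ^ j)) = 0"
  shows "card S < 6 * m\<^sup>2"
proof (rule ccontr)
  assume large: "\<not> ?thesis"
  let ?K = "{..<m} \<times> {..<m}"
  define R where "R = (\<lambda>e. \<Sum>(i, j)\<in>{(i, j) \<in> ?K. i + j = e}. smult (of_int (q (i, j))) (P ^ i * Q ^ j))"
  have deg: "degree (P ^ i * Q ^ j) = i + 2 * j" for i j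
  proof -
    have "P \<noteq> 0" "Q \<noteq> 0" using P Q by auto
    then show ?thesis using P Q by (simp add: degree_mult_eq degree_power_eq)
  qed
  have R0: "R e = 0" if "e < 2 * m" for e
  proof (rule exponential_polynomial_eq_0[where S = "{..<2 * m}" and n = "\<lambda>_. 3 * m" and Z = "ln ` S" and R = R])
    show "coeff (R e) i = 0" if "3 * m \<le> i" for e i
      unfolding R_def coeff_sum using that
      by (intro sum.neutral) (auto simp: coeff_eq_0 deg)
    have "inj_on ln S" using S(2) by (auto simp: inj_on_def)
    then show "(\<Sum>e<2 * m. 3 * m) \<le> card (ln ` S)"
      using large by (simp add: card_image power2_eq_square)
    show "(\<Sum>e<2 * m. exp (real e * t) * poly (R e) t) = 0" if "t \<in> ln ` S" for t
    proof -
      from that obtain x where x: "x \<in> S" "t = ln x" by blast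
      have ex: "exp (real e * t) = x ^ e" for e
        using S(2)[OF x(1)] x(2) by (simp add: exp_of_nat_mult)
      have "(\<Sum>e<2 * m. exp (real e * t) * poly (R e) t)
        = (\<Sum>e<2 * m. \<Sum>k\<in>{k \<in> ?K. fst k + snd k = e}. of_int (q k) * ((x * poly P t) ^ fst k * (x * poly Q t) ^ snd k))"
        unfolding R_def ex
        by (auto simp: poly_sum sum_distrib_left case_prod_unfold power_add power_mult_distrib intro!: sum.cong)
      also have "\<dots> = (\<Sum>k\<in>?K. of_int (q k) * ((x * poly P t) ^ fst k * (x * poly Q t) ^ snd k))"
        by (rule sum.group) auto
      also have "\<dots> = 0" using S(3)[OF x(1)] x(2) by (simp add: case_prod_unfold)
      finally show ?thesis .
    qed
  qed (use S(1) that in auto)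
  from nz obtain i0 j0 where ij: "(i0, j0) \<in> ?K" "q (i0, j0) \<noteq> 0" by auto
  have "R (i0 + j0) \<noteq> 0"
    unfolding R_def by (rule sum_powers_degree_1_2_neq_0[where q = q, OF P Q order_refl ij])
  with R0 ij show False by auto
qed

text \<open>
  The true order is \<open>T\<close> times powers of \<open>ln T\<close>; the cruder \<open>T\<^sup>2\<close> absorbs the constants and only affects
  the size of the degree \<open>m\<close> needed below.
\<close>

lemma norm_main_terms_le:
  fixes b c0 c1 :: real
  shows "\<forall>\<^sub>F T in at_top. \<forall>z\<in>cball (of_real T) (T / 2).
     norm (z * (Ln z + of_real b)) \<le> T\<^sup>2 \<and>
     norm (z * ((Ln z)\<^sup>2 / 2 + of_real c1 * Ln z + of_real c0)) \<le> T\<^sup>2"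
proof -
  define C where "C = \<bar>b\<bar> + \<bar>c0\<bar> + \<bar>c1\<bar> + 1"
  have "\<forall>\<^sub>F T :: real in at_top. C \<le> T powr (1 / 2)"
    using filterlim_at_top by (metis real_powr_at_top half_gt_zero_iff zero_less_one)
  moreover have "\<forall>\<^sub>F T :: real in at_top. 2 * T powr (1 / 2) * (ln (2 * T) + 5)\<^sup>2 \<le> T" by real_asymp
  moreover have "\<forall>\<^sub>F T :: real in at_top. T \<ge> 2" by (rule eventually_ge_at_top)
  ultimately show ?thesis
  proof eventually_elim
    case (elim T)
    define l where "l = ln (2 * T) + 4"
    have l: "l \<ge> 0" using elim(3) by (simp add: l_def)
    have C: "C \<ge> 1" "\<bar>b\<bar> \<le> C" "\<bar>c0\<bar> \<le> C" "\<bar>c1\<bar> \<le> C" by (auto simp: C_def)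
    have bound: "2 * T * (C * (l + 1)\<^sup>2) \<le> T\<^sup>2"
    proof -
      have "2 * C * (l + 1)\<^sup>2 \<le> 2 * T powr (1 / 2) * (l + 1)\<^sup>2"
        using elim(1) by (intro mult_right_mono mult_left_mono) auto
      also have "\<dots> \<le> T" using elim(2) by (simp add: l_def add.commute)
      finally have "T * (2 * C * (l + 1)\<^sup>2) \<le> T * T" using elim(3) by (intro mult_left_mono) auto
      then show ?thesis by (simp add: power2_eq_square mult_ac)
    qed
    show ?case
    proof
      fix z :: complex assume z: "z \<in> cball (of_real T) (T / 2)"
      have d: "norm (of_real T - z) \<le> T / 2" using z by (simp add: dist_norm)
      have nz: "norm z \<le> 2 * T"
        using norm_triangle_ineq4[of "of_real T" "of_real T - z"] d elim(3) by simp
      have "Re (of_real T - z) \<le> T / 2" using complex_Re_le_cmod d order_trans by blast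
      then have Rz: "Re z \<ge> 1" using elim(3) by simp
      then have nz1: "norm z \<ge> 1" using complex_Re_le_cmod[of z] by linarith
      then have "z \<noteq> 0" by auto
      have "norm (Ln z) \<le> \<bar>Re (Ln z)\<bar> + \<bar>Im (Ln z)\<bar>" by (rule cmod_le)
      also have "\<dots> \<le> ln (2 * T) + 4"
      proof (rule add_mono)
        show "\<bar>Re (Ln z)\<bar> \<le> ln (2 * T)" using \<open>z \<noteq> 0\<close> nz nz1 elim(3) by simp
        have "\<bar>Im (Ln z)\<bar> \<le> pi" using Im_Ln_le_pi[OF \<open>z \<noteq> 0\<close>] mpi_less_Im_Ln[OF \<open>z \<noteq> 0\<close>] by linarith
        then show "\<bar>Im (Ln z)\<bar> \<le> 4" using pi_less_4 by linarith
      qed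
      finally have L: "norm (Ln z) \<le> l" by (simp add: l_def)
      have "norm (Ln z + of_real b) \<le> l + C"
        using norm_triangle_ineq[of "Ln z" "of_real b"] L C by simp
      also have "\<dots> \<le> C * (l + 1)\<^sup>2"
      proof -
        have "1 * l \<le> C * l" using l C by (intro mult_right_mono) auto
        moreover have "0 \<le> C * l" "0 \<le> C * l\<^sup>2" using l C by simp_all
        ultimately show ?thesis by (simp add: power2_eq_square algebra_simps)
      qed
      finally have 1: "norm (Ln z + of_real b) \<le> C * (l + 1)\<^sup>2" .
      have "norm ((Ln z)\<^sup>2 / 2 + of_real c1 * Ln z + of_real c0) \<le> norm ((Ln z)\<^sup>2 / 2) + norm (of_real c1 * Ln z) + norm (of_real c0 :: complex)"
        by (intro norm_triangle_mono norm_triangle_ineq order_refl)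
      also have "\<dots> = (norm (Ln z))\<^sup>2 / 2 + \<bar>c1\<bar> * norm (Ln z) + \<bar>c0\<bar>"
        by (simp add: norm_mult norm_divide norm_power)
      also have "\<dots> \<le> l\<^sup>2 / 2 + C * l + C"
        using L C l by (intro add_mono divide_right_mono power_mono mult_mono) auto
      also have "\<dots> \<le> C * (l + 1)\<^sup>2"
      proof -
        have "1 * l\<^sup>2 \<le> C * l\<^sup>2" using C by (intro mult_right_mono) auto
        moreover have "0 \<le> C * l" "0 \<le> l\<^sup>2" using l C by simp_all
        moreover have "C * (l + 1)\<^sup>2 = C * l\<^sup>2 + 2 * (C * l) + C"
          by (simp add: power2_eq_square algebra_simps)
        ultimately show ?thesis by linarith
      qed
      finally have 2: "norm ((Ln z)\<^sup>2 / 2 + of_real c1 * Ln z + of_real c0) \<le> C * (l + 1)\<^sup>2" .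
      have fin: "norm (z * w) \<le> T\<^sup>2" if "norm w \<le> C * (l + 1)\<^sup>2" for w
      proof -
        have "norm (z * w) \<le> (2 * T) * (C * (l + 1)\<^sup>2)"
          unfolding norm_mult using nz that elim(3) by (intro mult_mono) auto
        with bound show ?thesis by simp
      qed
      show "norm (z * (Ln z + of_real b)) \<le> T\<^sup>2 \<and>
        norm (z * ((Ln z)\<^sup>2 / 2 + of_real c1 * Ln z + of_real c0)) \<le> T\<^sup>2"
        using fin[OF 1] fin[OF 2] by blast
    qed
  qed
qed

text \<open>
  The exponents are balanced as follows, with \<open>X\<close> about \<open>T\<close>. The monomials \<open>M2\<^sup>i M3\<^sup>j\<close>
  with \<open>i, j < m\<close> are at most \<open>X\<^sup>4\<^sup>m\<close> on the disc of radius \<open>T / 2\<close>, and the integer coefficients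
  are at most \<open>X\<^sup>4\<^sup>m\<close> as well. On the interval each further Taylor term gains a factor of order
  \<open>T powr (-1 / 10)\<close>, so the \<open>J\<close>-th remainder is negligible once \<open>J\<close> exceeds about
  \<open>10 * (8 * m)\<close>; about twice as many terms leave room for the constants. Making \<open>J\<close> linear forms of size up to \<open>X\<^sup>8\<^sup>m\<^sup>+\<^sup>1\<close> smaller than one costs
  \<open>(8 * m + 2) * J\<close> powers of \<open>X\<close>, quadratic in \<open>m\<close>, while the \<open>m\<^sup>2\<close> free coefficients provide
  \<open>4 * m * m\<^sup>2\<close> powers of \<open>X\<close>. So the last condition holds for all large \<open>m\<close>.
\<close>

lemma common_integer_values_bounded:
  fixes b c0 c1 :: real and m J :: nat
  defines "M2 \<equiv> \<lambda>x. x * (ln x + b)"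
    and "M3 \<equiv> \<lambda>x. x * ((ln x)\<^sup>2 / 2 + c1 * ln x + c0)"
  assumes J: "J = 20 * (8 * m + 3)" and less: "(8 * m + 2) * J < 4 * m * m\<^sup>2"
  shows "\<forall>\<^sub>F T in at_top. \<forall>S. finite S \<longrightarrow> S \<subseteq> {T..T + T powr (9 / 10)} \<longrightarrow>
     (\<forall>x\<in>S. M2 x \<in> \<int> \<and> M3 x \<in> \<int>) \<longrightarrow> card S < 6 * m\<^sup>2"
proof -
  have "\<forall>\<^sub>F T :: real in at_top. T powr (9 / 10) \<le> T / 4" by real_asymp
  \<comment> \<open>Twenty Taylor terms gain \<open>T\<^sup>2\<close>, that is one factor \<open>T\<close> after the constant \<open>2 ^ 20\<close> is absorbed.\<close>
  moreover have "\<forall>\<^sub>F T :: real in at_top. (2 * T powr (9 / 10) / T) ^ 20 \<le> 1 / (T + 1)" by real_asymp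
  moreover have "\<forall>\<^sub>F T :: real in at_top. T \<ge> real (4 * J * m\<^sup>2) + 4" by (rule eventually_ge_at_top)
  ultimately show ?thesis using norm_main_terms_le[of b c1 c0]
  proof eventually_elim
    case (elim T)
    define X where "X = nat \<lceil>T\<rceil>"
    have T4: "T \<ge> 4" using elim(3) of_nat_0_le_iff[of "4 * J * m\<^sup>2"] by linarith
    have X: "T \<le> real X" "real X \<le> T + 1" using T4 by (auto simp: X_def)
    have "real X \<ge> real (4 * J * m\<^sup>2)" using elim(3) X by linarith
    then have X1: "4 * J * m\<^sup>2 \<le> X" by linarith
    have X4: "X \<ge> 4" using X T4 by linarith
    define H where "H = T powr (9 / 10)"
    have H: "H > 0" "H \<le> T / 4" using T4 elim(1) by (auto simp: H_def)
    let ?K = "{..<m} \<times> {..<m}"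
    define f where "f = (\<lambda>k :: nat \<times> nat. \<lambda>z. (z * (Ln z + of_real b)) ^ fst k * (z * ((Ln z)\<^sup>2 / 2 + of_real c1 * Ln z + of_real c0)) ^ snd k)"
    define g where "g = (\<lambda>k :: nat \<times> nat. \<lambda>x. M2 x ^ fst k * M3 x ^ snd k)"
    define B where "B = real X ^ (4 * m)"
    have ReD: "Re z > 0" if "z \<in> cball (of_real T) (T / 2)" for z
    proof -
      have "norm (of_real T - z) \<le> T / 2" using that by (simp add: dist_norm)
      then have "Re (of_real T - z) \<le> T / 2" using complex_Re_le_cmod order_trans by blast
      then show ?thesis using T4 by simp
    qed
    \<comment> \<open>\<open>Tay k a\<close>: the numbers \<open>a r\<close> serve as Taylor coefficients of \<open>g k\<close> at \<open>T\<close>.\<close>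
    define Tay where "Tay = (\<lambda>k (a :: nat \<Rightarrow> real). (\<forall>r. \<bar>a r\<bar> \<le> B / (T / 2) ^ r) \<and>
        (\<forall>x. \<bar>x - T\<bar> \<le> (T / 2) / 2 \<longrightarrow> \<bar>g k x - (\<Sum>r<J. a r * (x - T) ^ r)\<bar> \<le> 2 * B * (\<bar>x - T\<bar> / (T / 2)) ^ J))"
    have "\<exists>a :: nat \<Rightarrow> real. Tay k a" if k: "k \<in> ?K" for k
    proof (rule taylor_polynomial_bound[of "f k" T "T / 2" B "g k"])
      show "f k holomorphic_on cball (of_real T) (T / 2)"
        unfolding f_def
        by (intro holomorphic_intros) (use ReD in \<open>force simp: complex_nonpos_Reals_iff\<close>)+
      show "norm (f k z) \<le> B" if z: "z \<in> cball (of_real T) (T / 2)" for z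
      proof -
        have "norm (f k z) \<le> (T\<^sup>2) ^ fst k * (T\<^sup>2) ^ snd k"
          unfolding f_def norm_mult norm_power using elim(4) z by (intro mult_mono power_mono) (auto simp flip: norm_mult)
        also have "\<dots> = T ^ (2 * fst k + 2 * snd k)" by (simp add: power_mult power_add)
        also have "\<dots> \<le> T ^ (4 * m)" using k T4 by (intro power_increasing) auto
        also have "\<dots> \<le> B" unfolding B_def using X T4 by (intro power_mono) auto
        finally show ?thesis .
      qed
      show "f k (of_real x) = of_real (g k x)" if "\<bar>x - T\<bar> \<le> T / 2" for x
      proof -
        have "x > 0" using that T4 by linarith
        then show ?thesis by (simp add: f_def g_def M2_def M3_def Ln_of_real)
      qed
    next
      fix c :: "nat \<Rightarrow> real"
      assume "\<And>r. \<bar>c r\<bar> \<le> B / (T / 2) ^ r"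
        "\<And>x J. \<bar>x - T\<bar> \<le> T / 2 / 2 \<Longrightarrow> \<bar>g k x - (\<Sum>r<J. c r * (x - T) ^ r)\<bar> \<le> 2 * B * (\<bar>x - T\<bar> / (T / 2)) ^ J"
      then have "Tay k c" by (simp add: Tay_def)
      then show "\<exists>a. Tay k a" by blast
    qed (use T4 in simp)
    then have "\<forall>k\<in>?K. \<exists>a. Tay k a" by (rule ballI)
    from bchoice[OF this] obtain a where aT: "\<forall>k\<in>?K. Tay k (a k)" by (rule exE)
    have a: "\<bar>a k r\<bar> \<le> B / (T / 2) ^ r"
      "\<bar>x - T\<bar> \<le> (T / 2) / 2 \<Longrightarrow> \<bar>g k x - (\<Sum>r<J. a k r * (x - T) ^ r)\<bar> \<le> 2 * B * (\<bar>x - T\<bar> / (T / 2)) ^ J"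
      if "k \<in> ?K" for k r x
      using bspec[OF aT that] unfolding Tay_def by blast+
    have J0: "J > 0" using J by simp
    \<comment> \<open>The factor \<open>4 * J\<close> leaves a total of \<open>1 / 4\<close> for the \<open>J\<close> Taylor terms together.\<close>
    obtain q :: "nat \<times> nat \<Rightarrow> int" where q: "\<exists>k\<in>?K. q k \<noteq> 0" "\<And>k. k \<in> ?K \<Longrightarrow> \<bar>q k\<bar> \<le> int (X ^ (4 * m))"
      "\<And>r. r < J \<Longrightarrow> \<bar>\<Sum>k\<in>?K. of_int (q k) * (a k r * H ^ r * real (4 * J))\<bar> < 1"
    proof (rule small_integer_combination[of ?K J "\<lambda>k r. a k r * H ^ r * real (4 * J)" "B * real (4 * J)" "X ^ (4 * m)" "X ^ (8 * m + 1)"])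
      show "\<bar>a k r * H ^ r * real (4 * J)\<bar> \<le> B * real (4 * J)" if "k \<in> ?K" for k r
      proof -
        have "\<bar>a k r\<bar> * H ^ r \<le> B / (T / 2) ^ r * (T / 2) ^ r"
          using H T4 a(1)[OF that] by (intro mult_mono power_mono) (auto intro: order_trans[OF abs_ge_zero a(1)[OF that]])
        also have "\<dots> = B" using T4 by simp
        finally have "\<bar>a k r\<bar> * H ^ r * real (4 * J) \<le> B * real (4 * J)" by (rule mult_right_mono) simp
        then show ?thesis using H by (simp add: abs_mult power_abs)
      qed
      have "card ?K * X ^ (4 * m) * (X ^ (4 * m) * (4 * J)) = (4 * J * m\<^sup>2) * X ^ (8 * m)"
        by (simp add: card_cartesian_product power2_eq_square algebra_simps flip: power_add)
      also have "\<dots> \<le> X * X ^ (8 * m)" using X1 by (rule mult_right_mono) simp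
      finally have "card ?K * X ^ (4 * m) * (X ^ (4 * m) * (4 * J)) \<le> X ^ (8 * m + 1)" by simp
      then show "real (card ?K) * real (X ^ (4 * m)) * (B * real (4 * J)) \<le> real (X ^ (8 * m + 1))"
        unfolding B_def by (metis of_nat_le_iff of_nat_mult of_nat_power)
      have "X ^ (8 * m + 1) \<ge> 1" using X4 by simp
      then have "2 * X ^ (8 * m + 1) + 1 \<le> 4 * X ^ (8 * m + 1)" by linarith
      also have "\<dots> \<le> X * X ^ (8 * m + 1)" using X4 by (rule mult_right_mono) simp
      finally have "2 * X ^ (8 * m + 1) + 1 \<le> X ^ (8 * m + 2)" by simp
      then have "(2 * X ^ (8 * m + 1) + 1) ^ J \<le> (X ^ (8 * m + 2)) ^ J" by (rule power_mono) simp
      also have "\<dots> = X ^ ((8 * m + 2) * J)" by (simp only: power_mult)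
      also have "\<dots> < X ^ (4 * m * m\<^sup>2)" using less X4 by (intro power_strict_increasing) auto
      also have "\<dots> = (X ^ (4 * m)) ^ card ?K" by (simp add: card_cartesian_product power2_eq_square flip: power_mult)
      finally show "(2 * X ^ (8 * m + 1) + 1) ^ J < (X ^ (4 * m)) ^ card ?K" .
    qed auto
    have main: "\<bar>\<Sum>k\<in>?K. of_int (q k) * (\<Sum>r<J. a k r * (x - T) ^ r)\<bar> \<le> 1 / 4" if x: "x \<in> {T..T + H}" for x
    proof -
      define y where "y = (x - T) / H"
      have y: "0 \<le> y" "y \<le> 1" using x H by (auto simp: y_def)
      have "(\<Sum>k\<in>?K. of_int (q k) * (\<Sum>r<J. a k r * (x - T) ^ r))
          = (\<Sum>r<J. (\<Sum>k\<in>?K. of_int (q k) * (a k r * H ^ r * real (4 * J))) * y ^ r / real (4 * J))"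
        unfolding sum_distrib_left sum_distrib_right sum_divide_distrib
        by (subst sum.swap) (use H J0 in \<open>auto intro!: sum.cong simp: y_def power_divide field_simps\<close>)
      also have "\<bar>\<dots>\<bar> \<le> (\<Sum>r<J. 1 / real (4 * J))"
      proof (rule order_trans[OF sum_abs sum_mono])
        fix r assume r: "r \<in> {..<J}"
        have "\<bar>\<Sum>k\<in>?K. of_int (q k) * (a k r * H ^ r * real (4 * J))\<bar> * y ^ r \<le> 1 * 1"
          using q(3)[of r] r y by (intro mult_mono power_le_one) auto
        then have "\<bar>\<Sum>k\<in>?K. of_int (q k) * (a k r * H ^ r * real (4 * J))\<bar> * y ^ r / real (4 * J) \<le> (1 * 1) / real (4 * J)"
          by (rule divide_right_mono) simp
        then show "\<bar>(\<Sum>k\<in>?K. of_int (q k) * (a k r * H ^ r * real (4 * J))) * y ^ r / real (4 * J)\<bar> \<le> 1 / real (4 * J)"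
          using y by (simp only: abs_divide abs_mult power_abs abs_of_nat abs_of_nonneg mult_1)
      qed
      also have "\<dots> = 1 / 4" using J0 by simp
      finally show ?thesis .
    qed
    have err: "\<bar>\<Sum>k\<in>?K. of_int (q k) * (g k x - (\<Sum>r<J. a k r * (x - T) ^ r))\<bar> \<le> 1 / 2" if x: "x \<in> {T..T + H}" for x
    proof -
      have e: "2 * B * (\<bar>x - T\<bar> / (T / 2)) ^ J \<le> 2 * B * (1 / real X) ^ (8 * m + 3)"
      proof -
        have "2 * \<bar>x - T\<bar> / T \<le> 2 * H / T" using x T4 by (intro divide_right_mono) auto
        then have "(\<bar>x - T\<bar> / (T / 2)) ^ J \<le> (2 * H / T) ^ J"
          using T4 by (intro power_mono) (auto simp: mult.commute)
        also have "\<dots> = ((2 * H / T) ^ 20) ^ (8 * m + 3)" unfolding J by (simp only: power_mult)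
        also have "\<dots> \<le> (1 / (T + 1)) ^ (8 * m + 3)"
          using elim(2) H T4 unfolding H_def by (intro power_mono) auto
        also have "\<dots> \<le> (1 / real X) ^ (8 * m + 3)"
          using X X4 T4 by (intro power_mono divide_left_mono) auto
        finally show ?thesis by (intro mult_left_mono) (auto simp: B_def)
      qed
      have "\<bar>\<Sum>k\<in>?K. of_int (q k) * (g k x - (\<Sum>r<J. a k r * (x - T) ^ r))\<bar> \<le> (\<Sum>k\<in>?K. B * (2 * B * (1 / real X) ^ (8 * m + 3)))"
      proof (rule order_trans[OF sum_abs sum_mono])
        fix k assume k: "k \<in> ?K"
        have "real_of_int \<bar>q k\<bar> \<le> B" using q(2)[OF k] unfolding B_def by (metis of_int_le_iff of_int_of_nat_eq of_nat_power)
        moreover have "\<bar>x - T\<bar> \<le> (T / 2) / 2" using x H by auto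
        ultimately have "\<bar>real_of_int (q k)\<bar> * \<bar>g k x - (\<Sum>r<J. a k r * (x - T) ^ r)\<bar> \<le> B * (2 * B * (1 / real X) ^ (8 * m + 3))"
          using a(2)[OF k, of x] e by (intro mult_mono) (auto simp: B_def)
        then show "\<bar>real_of_int (q k) * (g k x - (\<Sum>r<J. a k r * (x - T) ^ r))\<bar> \<le> B * (2 * B * (1 / real X) ^ (8 * m + 3))"
          by (simp only: abs_mult)
      qed
      also have "\<dots> = 2 * real (m\<^sup>2) * (B * B * (1 / real X) ^ (8 * m)) * (1 / real X) ^ 3"
        by (simp add: card_cartesian_product power2_eq_square power_add)
      also have "B * B * (1 / real X) ^ (8 * m) = 1"
        unfolding B_def using X4 by (simp add: power_divide flip: power_add)
      also have "2 * real (m\<^sup>2) * 1 * (1 / real X) ^ 3 \<le> 2 * real (m\<^sup>2) * (1 / real X)"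
      proof -
        have "(1 / real X) ^ 3 \<le> (1 / real X) ^ 1" using X4 by (intro power_decreasing) auto
        then have "(1 / real X) ^ 3 \<le> 1 / real X" by (simp only: power_one_right)
        then have "2 * real (m\<^sup>2) * (1 / real X) ^ 3 \<le> 2 * real (m\<^sup>2) * (1 / real X)"
          by (rule mult_left_mono) simp
        then show ?thesis by (simp only: mult_1_right)
      qed
      also have "\<dots> \<le> 1 / 2"
      proof -
        have "4 * m\<^sup>2 \<le> 4 * J * m\<^sup>2" using J0 by simp
        then have "4 * m\<^sup>2 \<le> X" using X1 by linarith
        then have "4 * real (m\<^sup>2) \<le> real X" by (metis of_nat_le_iff of_nat_mult of_nat_numeral)
        then show ?thesis using X4 by (simp add: field_simps)
      qed
      finally show ?thesis .
    qed
    show ?case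
    proof (intro allI impI)
      fix S assume S: "finite S" "S \<subseteq> {T..T + T powr (9 / 10)}" "\<forall>x\<in>S. M2 x \<in> \<int> \<and> M3 x \<in> \<int>"
      show "card S < 6 * m\<^sup>2"
      proof (rule common_zeros_card_less[where P = "[:b, 1:]" and Q = "[:c0, c1, 1 / 2:]" and q = q])
        show "x > 0" if "x \<in> S" for x using that S(2) T4 by force
        show "(\<Sum>(i, j)\<in>?K. of_int (q (i, j)) * ((x * poly [:b, 1:] (ln x)) ^ i * (x * poly [:c0, c1, 1 / 2:] (ln x)) ^ j)) = 0"
          if x: "x \<in> S" for x
        proof -
          have xT: "x \<in> {T..T + H}" using x S(2) by (auto simp: H_def)
          define F where "F = (\<Sum>k\<in>?K. of_int (q k) * g k x)"
          have "F = (\<Sum>k\<in>?K. of_int (q k) * (\<Sum>r<J. a k r * (x - T) ^ r))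
              + (\<Sum>k\<in>?K. of_int (q k) * (g k x - (\<Sum>r<J. a k r * (x - T) ^ r)))"
            unfolding F_def sum.distrib[symmetric] by (simp add: algebra_simps)
          then have "\<bar>F\<bar> < 1" using main[OF xT] err[OF xT] by linarith
          moreover have "F \<in> \<int>" unfolding F_def g_def using S(3) x by (intro Ints_sum Ints_mult Ints_power) auto
          ultimately have "F = 0" using Ints_nonzero_abs_less1 by blast
          moreover have "x * poly [:b, 1:] (ln x) = M2 x" "x * poly [:c0, c1, 1 / 2:] (ln x) = M3 x"
            by (simp_all add: M2_def M3_def power2_eq_square algebra_simps)
          ultimately show ?thesis by (simp only: F_def g_def case_prod_unfold prod.collapse)
        qed
      qed (use S q in auto)
    qed
  qed
qed

section \<open>The hyperbola method and its sawtooth functions\<close>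

lemma num_factorizations_2:
  "num_factorizations 2 n = card {(a, b). 0 < a \<and> 0 < b \<and> a * b = n}"
proof -
  have "{ms :: nat list. length ms = 2 \<and> (\<forall>m\<in>set ms. m > 0) \<and> prod_list ms = n}
      = (\<lambda>(a, b). [a, b]) ` {(a, b). 0 < a \<and> 0 < b \<and> a * b = n}"
    by (auto simp: length_Suc_conv numeral_2_eq_2)
  moreover have "inj_on (\<lambda>(a, b). [a, b]) X" for X :: "(nat \<times> nat) set"
    by (auto simp: inj_on_def)
  ultimately show ?thesis by (simp add: num_factorizations_def card_image)
qed

definition divisor_sum :: "nat \<Rightarrow> nat \<Rightarrow> nat" where
  "divisor_sum k n = (\<Sum>m\<in>{1..n}. num_factorizations k m)"

text \<open>
  Dirichlet's hyperbola method: the lattice points \<open>(a, b)\<close> under the hyperbola are counted by columns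
  for \<open>a \<le> A\<close> and by rows for \<open>a > A\<close>. The cut \<open>A\<close> does not move with \<open>n\<close>; this keeps the sawtooth functions
  in the first sum the same throughout a window of values of \<open>n\<close>.
\<close>

lemma sum_divisors_hyperbola:
  assumes "A > 0"
  shows "divisor_sum 2 n = (\<Sum>a\<in>{1..A}. n div a) + (\<Sum>b\<in>{1..n div A}. n div b - A)"
proof -
  let ?P = "\<lambda>a b. 0 < a \<and> 0 < b \<and> a * b \<le> n"
  have fin: "finite {(a, b). ?P a b}"
  proof (rule finite_subset)
    show "{(a, b). ?P a b} \<subseteq> {1..n} \<times> {1..n}"
    proof clarify
      fix a b assume ab: "0 < a" "0 < b" "a * b \<le> n"
      have "a * 1 \<le> a * b" "1 * b \<le> a * b" using ab by (intro mult_le_mono; simp)+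
      with ab have "a \<le> n" "b \<le> n" by linarith+
      with ab show "a \<in> {1..n} \<and> b \<in> {1..n}" by auto
    qed
  qed auto
  have "divisor_sum 2 n = card (\<Union>m\<in>{1..n}. {(a, b). 0 < a \<and> 0 < b \<and> a * b = m})"
    unfolding divisor_sum_def num_factorizations_2
    by (rule card_UN_disjoint[symmetric])
       (auto intro: finite_subset[OF _ fin])
  also have "(\<Union>m\<in>{1..n}. {(a, b). 0 < a \<and> 0 < b \<and> a * b = m})
      = (SIGMA a:{1..A}. {1..n div a}) \<union> prod.swap ` (SIGMA b:{1..n div A}. {A<..n div b})" (is "?L = ?R1 \<union> ?R2")
  proof -
    have "(a, b) \<in> ?L \<longleftrightarrow> (a, b) \<in> ?R1 \<union> ?R2" for a b
    proof
      assume "(a, b) \<in> ?L"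
      then have ab: "0 < a" "0 < b" "a * b \<le> n" by auto
      show "(a, b) \<in> ?R1 \<union> ?R2"
      proof (cases "a \<le> A")
        case True
        then show ?thesis using ab by (auto simp: less_eq_div_iff_mult_less_eq mult.commute)
      next
        case False
        then have "A * b \<le> n" using ab by (meson le_trans mult_le_mono1 nat_le_linear)
        then have "(b, a) \<in> (SIGMA b:{1..n div A}. {A<..n div b})"
          using ab False assms by (auto simp: less_eq_div_iff_mult_less_eq mult.commute)
        then show ?thesis by force
      qed
    next
      assume "(a, b) \<in> ?R1 \<union> ?R2"
      then have "0 < a \<and> 0 < b \<and> a * b \<le> n" using assms
        by (auto simp: less_eq_div_iff_mult_less_eq mult.commute Suc_le_eq)
      then show "(a, b) \<in> ?L" by (auto simp: Suc_le_eq)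
    qed
    then show ?thesis by (intro set_eqI) (simp only: split_paired_all)
  qed
  also have "card (?R1 \<union> ?R2) = card ?R1 + card ?R2"
    by (rule card_Un_disjoint) auto
  also have "card ?R2 = card (SIGMA b:{1..n div A}. {A<..n div b})"
    by (rule card_image) (auto simp: inj_on_def)
  finally show ?thesis by simp
qed


text \<open>
  The rounding error of \<open>n div a\<close>, corrected by \<open>1 / (2 a)\<close>: the correction gives it mean zero over the
  integers of a period.
\<close>

definition sawtooth :: "nat \<Rightarrow> nat \<Rightarrow> real" where
  "sawtooth a n = 1 / 2 - 1 / (2 * real a) - real (n mod a) / real a"

lemma real_div_eq_sawtooth:
  assumes "a > 0"
  shows "real (n div a) = real n / real a - 1 / 2 + 1 / (2 * real a) + sawtooth a n"
proof -
  have "real n = real (n div a) * real a + real (n mod a)"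
    by (metis div_mult_mod_eq of_nat_add of_nat_mult)
  then show ?thesis using assms by (simp add: sawtooth_def field_simps)
qed

lemma abs_sawtooth_le: "a > 0 \<Longrightarrow> \<bar>sawtooth a n\<bar> \<le> 1 / 2"
proof -
  assume a: "a > 0"
  have "real (n mod a) \<le> real a - 1" using mod_less_divisor[OF a, of n] a by linarith
  then have "real (n mod a) / real a \<le> 1 - 1 / real a" using a by (simp add: field_simps)
  moreover have "0 \<le> 1 / real a" "1 / real a \<le> 1" "0 \<le> real (n mod a) / real a" using a by auto
  moreover have "1 / (2 * real a) = (1 / real a) / 2" by simp
  ultimately show ?thesis unfolding sawtooth_def by linarith
qed

lemma sawtooth_periodic: "sawtooth a (n + a) = sawtooth a n"
  by (simp add: sawtooth_def)

lemma sum_sawtooth_period: "(\<Sum>j<a. sawtooth a j) = 0"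
proof (cases "a = 0")
  case False
  have "(\<Sum>j<a. sawtooth a j) = (\<Sum>j<a. (1 / 2 - 1 / (2 * real a)) - real j / real a)"
    by (intro sum.cong) (auto simp: sawtooth_def)
  also have "\<dots> = real a * (1 / 2 - 1 / (2 * real a)) - (\<Sum>j<a. real j) / real a"
    by (simp add: sum_subtractf sum_divide_distrib)
  also have "(\<Sum>j<a. real j) = real a * (real a - 1) / 2"
  proof (induction a)
    case (Suc a) then show ?case by (simp add: field_simps)
  qed simp
  finally show ?thesis using False by (simp add: field_simps)
qed simp

lemma sum_periodic_shift:
  fixes f :: "nat \<Rightarrow> real"
  assumes "\<And>n. f (n + a) = f n"
  shows "(\<Sum>j<a. f (n + j)) = (\<Sum>j<a. f j)"
proof (induction n)
  case (Suc n)
  have "(\<Sum>j<a. f (Suc n + j)) + f n = (\<Sum>j<Suc a. f (n + j))"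
    by (subst sum.lessThan_Suc_shift) simp
  also have "\<dots> = (\<Sum>j<a. f (n + j)) + f n" using assms[of n] by simp
  finally show ?case using Suc.IH by simp
qed simp

lemma sum_lessThan_add:
  fixes f :: "nat \<Rightarrow> real"
  shows "(\<Sum>j<m + n. f j) = (\<Sum>j<m. f j) + (\<Sum>j<n. f (m + j))"
  by (induction n) auto

text \<open>
  Complete periods cancel, and at most one incomplete period remains.
\<close>

lemma sum_mean_zero_periodic_le:
  fixes f :: "nat \<Rightarrow> real"
  assumes "a > 0" and per: "\<And>n. f (n + a) = f n" and zero: "(\<Sum>j<a. f j) = 0"
    and bd: "\<And>n. \<bar>f n\<bar> \<le> C"
  shows "\<bar>\<Sum>j<h. f (m + j)\<bar> \<le> C * real a"
proof (induction h rule: less_induct)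
  case (less h)
  show ?case
  proof (cases "h < a")
    case True
    have "0 \<le> C" using bd[of 0] by linarith
    have "\<bar>\<Sum>j<h. f (m + j)\<bar> \<le> (\<Sum>j<h. C)"
      by (rule order_trans[OF sum_abs sum_mono]) (rule bd)
    also have "\<dots> \<le> C * real a" using True \<open>0 \<le> C\<close> by (simp add: mult_mono mult.commute)
    finally show ?thesis .
  next
    case False
    have "(\<Sum>j<h. f (m + j)) = (\<Sum>j<(h - a) + a. f (m + j))" using False by simp
    also have "\<dots> = (\<Sum>j<h - a. f (m + j)) + (\<Sum>j<a. f ((m + (h - a)) + j))"
      by (simp only: sum_lessThan_add add.assoc)
    also have "\<dots> = (\<Sum>j<h - a. f (m + j))"
      by (simp only: sum_periodic_shift[of f, OF per] zero)
    finally show ?thesis using less[of "h - a"] False assms(1) by simp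
  qed
qed

text \<open>
  The inner sums are differences of the partial sums \<open>P\<close>, which are again \<open>a\<close>-periodic and of size
  \<open>O(a)\<close>; since the difference of two shifts of \<open>P\<close> has mean zero, the second summation gains another
  factor \<open>h / a\<close> over the trivial bound.
\<close>

lemma double_sum_sawtooth_le:
  assumes "a > 0"
  shows "\<bar>\<Sum>u<h. \<Sum>v<h. sawtooth a (N + u + v)\<bar> \<le> (real a)\<^sup>2"
proof -
  define P where "P = (\<lambda>m. \<Sum>j<m. sawtooth a j)"
  have Pper: "P (m + a) = P m" for m
    unfolding P_def sum_lessThan_add
    by (simp only: sum_periodic_shift[of "sawtooth a", OF sawtooth_periodic] sum_sawtooth_period)
  have Pbd: "\<bar>P m\<bar> \<le> 1 / 2 * real a" for m
    using sum_mean_zero_periodic_le[where f = "sawtooth a" and m = 0 and h = m and C = "1 / 2",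
        OF assms sawtooth_periodic sum_sawtooth_period abs_sawtooth_le[OF assms]]
    by (simp add: P_def)
  define F where "F = (\<lambda>j. P (N + h + j) - P (N + j))"
  have "\<bar>\<Sum>j<h. F (0 + j)\<bar> \<le> real a * real a"
  proof (rule sum_mean_zero_periodic_le[OF assms])
    show "F (j + a) = F j" for j
      using Pper[of "N + h + j"] Pper[of "N + j"] by (simp add: F_def add.assoc)
    show "sum F {..<a} = 0"
      unfolding F_def sum_subtractf by (simp only: sum_periodic_shift[of P, OF Pper])
    show "\<bar>F j\<bar> \<le> real a" for j
      using Pbd[of "N + h + j"] Pbd[of "N + j"] by (simp add: F_def)
  qed
  moreover have "F u = (\<Sum>v<h. sawtooth a (N + u + v))" for u
  proof -
    have "N + h + u = (N + u) + h" by simp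
    then show ?thesis unfolding F_def P_def by (simp only: sum_lessThan_add)
  qed
  ultimately show ?thesis by (simp add: power2_eq_square)
qed

text \<open>
  This serves the few rows \<open>b\<close> of the hyperbola method that begin only inside the window: a single
  summation suffices for them.
\<close>

lemma sum_sawtooth_tail_le:
  assumes "a > 0"
  shows "\<bar>\<Sum>v<h. if k \<le> m + v then sawtooth a (m + v) else 0\<bar> \<le> real a"
proof -
  define l where "l = min h (k - m)"
  have "(\<Sum>v<h. if k \<le> m + v then sawtooth a (m + v) else 0)
      = (\<Sum>v<l + (h - l). if k \<le> m + v then sawtooth a (m + v) else 0)"
    by (simp add: l_def)
  also have "\<dots> = (\<Sum>v<l. 0) + (\<Sum>v<h - l. sawtooth a ((m + l) + v))"
    unfolding sum_lessThan_add by (intro arg_cong2[where f = "(+)"] sum.cong) (auto simp: l_def min_def add.assoc split: if_splits)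
  finally show ?thesis
    using sum_mean_zero_periodic_le[where f = "sawtooth a" and m = "m + l" and h = "h - l" and C = "1 / 2",
        OF assms sawtooth_periodic sum_sawtooth_period abs_sawtooth_le[OF assms]]
    by simp
qed

definition sawtooth_sum :: "nat \<Rightarrow> nat \<Rightarrow> real" where
  "sawtooth_sum A n = (\<Sum>a\<in>{1..A}. sawtooth a n) + (\<Sum>b\<in>{1..n div A}. sawtooth b n)"

text \<open>
  The columns and the rows that are present throughout the window contribute at most the sum of the squares
  of their periods, \<open>O(A\<^sup>3)\<close>. The rows that begin inside the window number \<open>O(h / A + 1)\<close>, and each
  contributes \<open>O(h * A)\<close>.
\<close>

lemma double_sum_sawtooth_sum_le:
  fixes A N h :: nat
  assumes A: "A > 0" and N: "N \<le> 4 * A\<^sup>2" and h: "A ^ 3 \<le> h\<^sup>2" "2 * h \<le> N"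
  shows "\<bar>\<Sum>u<h. \<Sum>v<h. sawtooth_sum A (N + u + v)\<bar> \<le> 89 * (real h)\<^sup>2"
proof -
  define B where "B = N div A"
  define B' where "B' = (N + 2 * h) div A"
  have "B \<le> B'" unfolding B_def B'_def by (intro div_le_mono) auto
  have rB: "real B \<le> 4 * real A"
  proof -
    have "N div A \<le> (4 * A\<^sup>2) div A" by (rule div_le_mono[OF N])
    also have "\<dots> = 4 * A" using A by (simp add: power2_eq_square)
    finally show ?thesis by (simp add: B_def)
  qed
  have rB': "real B' \<le> 8 * real A"
  proof -
    have "(N + 2 * h) div A \<le> (8 * A\<^sup>2) div A" by (rule div_le_mono) (use N h in linarith)
    also have "\<dots> = 8 * A" using A by (simp add: power2_eq_square)
    finally show ?thesis by (simp add: B'_def)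
  qed
  have cnt: "(real B' - real B) * real A \<le> 2 * real h + real A"
  proof -
    have "B' * A \<le> N + 2 * h" unfolding B'_def by simp
    moreover have "N \<le> B * A + A" unfolding B_def using A
      by (metis div_mult_mod_eq add_left_mono less_imp_le mod_less_divisor)
    ultimately have "B' * A \<le> B * A + A + 2 * h" by linarith
    then have "real B' * real A \<le> real B * real A + real A + 2 * real h"
      by (metis (mono_tags) of_nat_add of_nat_le_iff of_nat_mult of_nat_numeral)
    then show ?thesis by (simp add: algebra_simps)
  qed
  have h3: "real A ^ 3 \<le> (real h)\<^sup>2"
    using h(1) by (metis of_nat_le_iff of_nat_power)
  have hA: "A \<le> h"
  proof -
    have "A ^ 2 \<le> A ^ 3" using A by (intro power_increasing) auto
    then have "A\<^sup>2 \<le> h\<^sup>2" using h(1) by linarith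
    then show ?thesis by (simp add: power2_nat_le_eq_le)
  qed
  \<comment> \<open>The rows up to \<open>B\<close> are present in the whole window, those from \<open>B + 1\<close> to \<open>B'\<close> only from \<open>n = b * A\<close> on.\<close>
  define t where "t = (\<lambda>b n. if b * A \<le> n then sawtooth b n else 0)"
  have split: "sawtooth_sum A n = (\<Sum>a\<in>{1..A}. sawtooth a n) + (\<Sum>b\<in>{1..B}. sawtooth b n) + (\<Sum>b\<in>{B<..B'}. t b n)"
    if n: "N \<le> n" "n < N + 2 * h" for n
  proof -
    have le: "B \<le> n div A" "n div A \<le> B'" unfolding B_def B'_def using n by (intro div_le_mono; simp)+
    have "(\<Sum>b\<in>{1..n div A}. sawtooth b n) = (\<Sum>b\<in>{1..B}. sawtooth b n) + (\<Sum>b\<in>{B<..n div A}. sawtooth b n)"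
      by (subst sum.union_disjoint[symmetric]) (use le in \<open>auto intro!: sum.cong\<close>)
    also have "(\<Sum>b\<in>{B<..n div A}. sawtooth b n) = (\<Sum>b\<in>{B<..B'}. t b n)"
    proof (rule sum.mono_neutral_cong_left)
      have iff: "b * A \<le> n \<longleftrightarrow> b \<le> n div A" for b
        using A by (simp add: less_eq_div_iff_mult_less_eq)
      show "\<forall>b\<in>{B<..B'} - {B<..n div A}. t b n = 0"
        unfolding t_def iff by auto
      show "sawtooth b n = t b n" if "b \<in> {B<..n div A}" for b
        using that unfolding t_def iff by auto
    qed (use le in auto)
    finally show ?thesis by (simp add: sawtooth_sum_def)
  qed
  have "(\<Sum>u<h. \<Sum>v<h. sawtooth_sum A (N + u + v)) =
     (\<Sum>u<h. \<Sum>v<h. (\<Sum>a\<in>{1..A}. sawtooth a (N + u + v)) + (\<Sum>b\<in>{1..B}. sawtooth b (N + u + v))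
        + (\<Sum>b\<in>{B<..B'}. t b (N + u + v)))"
    by (intro sum.cong refl split) auto
  also have "\<dots> = (\<Sum>a\<in>{1..A}. \<Sum>u<h. \<Sum>v<h. sawtooth a (N + u + v))
       + (\<Sum>b\<in>{1..B}. \<Sum>u<h. \<Sum>v<h. sawtooth b (N + u + v))
       + (\<Sum>b\<in>{B<..B'}. \<Sum>u<h. \<Sum>v<h. t b (N + u + v))"
  proof -
    have sw: "(\<Sum>u<h. \<Sum>v<h. \<Sum>a\<in>X. g a u v) = (\<Sum>a\<in>X. \<Sum>u<h. \<Sum>v<h. g a u v)"
      for X and g :: "nat \<Rightarrow> nat \<Rightarrow> nat \<Rightarrow> real"
      by (subst sum.swap[of _ X]) (intro sum.cong refl sum.swap)
    show ?thesis by (simp only: sum.distrib sw)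
  qed
  finally have eq: "(\<Sum>u<h. \<Sum>v<h. sawtooth_sum A (N + u + v)) = \<dots>" .
  have sq: "\<bar>\<Sum>a\<in>{1..K}. \<Sum>u<h. \<Sum>v<h. sawtooth a (N + u + v)\<bar> \<le> real K ^ 3" for K
  proof -
    have "\<bar>\<Sum>a\<in>{1..K}. \<Sum>u<h. \<Sum>v<h. sawtooth a (N + u + v)\<bar> \<le> (\<Sum>a\<in>{1..K}. (real K)\<^sup>2)"
    proof (rule order_trans[OF sum_abs sum_mono])
      fix a assume a: "a \<in> {1..K}"
      have "\<bar>\<Sum>u<h. \<Sum>v<h. sawtooth a (N + u + v)\<bar> \<le> (real a)\<^sup>2"
        using a by (intro double_sum_sawtooth_le) auto
      also have "\<dots> \<le> (real K)\<^sup>2" using a by (intro power_mono) auto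
      finally show "\<bar>\<Sum>u<h. \<Sum>v<h. sawtooth a (N + u + v)\<bar> \<le> (real K)\<^sup>2" .
    qed
    then show ?thesis by (simp add: power2_eq_square power3_eq_cube)
  qed
  have "real B ^ 3 \<le> (4 * real A) ^ 3" using rB by (intro power_mono) auto
  also have "\<dots> \<le> 64 * (real h)\<^sup>2" using h3 by (simp add: power_mult_distrib)
  finally have B3: "real B ^ 3 \<le> 64 * (real h)\<^sup>2" .
  have "\<bar>\<Sum>b\<in>{B<..B'}. \<Sum>u<h. \<Sum>v<h. t b (N + u + v)\<bar> \<le> (\<Sum>b\<in>{B<..B'}. real h * (8 * real A))"
  proof (rule order_trans[OF sum_abs sum_mono])
    fix b assume b: "b \<in> {B<..B'}"
    have "\<bar>\<Sum>u<h. \<Sum>v<h. t b (N + u + v)\<bar> \<le> (\<Sum>u<h. 8 * real A)"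
    proof (rule order_trans[OF sum_abs sum_mono])
      fix u
      have "\<bar>\<Sum>v<h. t b (N + u + v)\<bar> \<le> real b"
        unfolding t_def using b by (intro sum_sawtooth_tail_le) auto
      also have "\<dots> \<le> 8 * real A" using b rB' by auto
      finally show "\<bar>\<Sum>v<h. t b (N + u + v)\<bar> \<le> 8 * real A" .
    qed
    then show "\<bar>\<Sum>u<h. \<Sum>v<h. t b (N + u + v)\<bar> \<le> real h * (8 * real A)" by simp
  qed
  also have "\<dots> = 8 * real h * ((real B' - real B) * real A)"
    using \<open>B \<le> B'\<close> by (simp add: of_nat_diff)
  also have "\<dots> \<le> 8 * real h * (2 * real h + real A)" by (intro mult_left_mono cnt) auto
  also have "\<dots> \<le> 8 * real h * (3 * real h)" using hA by (intro mult_left_mono) auto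
  finally have "\<bar>\<Sum>b\<in>{B<..B'}. \<Sum>u<h. \<Sum>v<h. t b (N + u + v)\<bar> \<le> 24 * (real h)\<^sup>2"
    by (simp add: power2_eq_square)
  with sq[of A] sq[of B] B3 h3 show ?thesis
    unfolding eq by linarith
qed


section \<open>Sign changes of the error term in Dirichlet's divisor problem\<close>

lemma harm_approx:
  assumes "k > 0"
  shows "\<bar>harm k - ln (real k) - euler_mascheroni - 1 / (2 * real k)\<bar> \<le> 1 / (real k)\<^sup>2"
proof -
  have k: "real k > 0" using assms by simp
  have b: "euler_mascheroni \<ge> harm k - ln (real k + 1) + 1 / (2 * (real k + 1))"
    "euler_mascheroni \<le> harm k - ln (real k + 1) + 1 / (2 * real k)"
    using euler_mascheroni_bounds[of k] assms by (auto simp: inverse_eq_divide add.commute)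
  have l: "ln (real k + 1) = ln (real k) + ln (1 + 1 / real k)"
  proof -
    have "real k + 1 = real k * (1 + 1 / real k)" using k by (simp add: field_simps)
    then have "ln (real k + 1) = ln (real k * (1 + 1 / real k))" by simp
    also have "\<dots> = ln (real k) + ln (1 + 1 / real k)"
      using k by (intro ln_mult_pos) (auto intro: add_pos_pos)
    finally show ?thesis .
  qed
  have u: "ln (1 + 1 / real k) \<le> 1 / real k" using k by (intro ln_add_one_self_le_self) auto
  have "1 / real k - (1 / real k)\<^sup>2 \<le> ln (1 + 1 / real k)"
    using assms by (intro ln_one_plus_pos_lower_bound) auto
  then have lo: "1 / real k - 1 / (real k)\<^sup>2 \<le> ln (1 + 1 / real k)" by (simp add: power_divide)
  have e: "1 / real k = 2 * (1 / (2 * real k))" by simp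
  have "1 / (2 * real k) - 1 / (2 * (real k + 1)) = 1 / (2 * (real k * (real k + 1)))"
    using k by (simp add: field_simps)
  also have "\<dots> \<le> 1 / (real k)\<^sup>2"
    using k by (intro divide_left_mono) (auto simp: power2_eq_square intro!: mult_pos_pos)
  finally have d: "1 / (2 * real k) - 1 / (2 * (real k + 1)) \<le> 1 / (real k)\<^sup>2" .
  show ?thesis using b l u lo d e by linarith
qed

text \<open>
  Put \<open>B = n div A\<close> and \<open>r = n mod A\<close>. The harmonic sums of the hyperbola method are expanded to the order
  \<open>1 / A\<^sup>2\<close>, since they get multiplied by \<open>n\<close>. The terms \<open>n / (2 A)\<close> and \<open>n / (2 B)\<close> cancel the
  halves \<open>-B / 2\<close> and \<open>-A / 2\<close> that come from rounding down, and \<open>n ln (A B) - A B\<close> equals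
  \<open>n ln n - n\<close> up to \<open>O(1)\<close>. The summand \<open>ln n / 2\<close> is, up to \<open>O(1)\<close>, half the sum of the two harmonic numbers; it
  comes from the fact that the mean of \<open>n div a - n / a\<close> over a period is \<open>-1 / 2 + 1 / (2 a)\<close>.
\<close>

lemma divisor_sum_2_approx:
  fixes A n :: nat
  assumes A: "A \<ge> 2" "A\<^sup>2 \<le> n" "n \<le> 8 * A\<^sup>2"
  defines "M \<equiv> real n * ln (real n) + (2 * euler_mascheroni - 1) * real n"
  shows "\<bar>real (divisor_sum 2 n) - M - ln (real n) / 2 - sawtooth_sum A n\<bar> \<le> 20"
proof -
  define B where "B = n div A"
  define r where "r = n mod A"
  have n: "n = B * A + r" by (simp add: B_def r_def)
  have r: "r < A" using A by (simp add: r_def)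
  have BA: "A \<le> B" unfolding B_def using A by (simp add: less_eq_div_iff_mult_less_eq power2_eq_square)
  have "0 < A\<^sup>2" using A by simp
  then have np: "real n > 0" using A(2) by linarith
  have Ap: "real A > 0" "real A \<ge> 2" and Bp: "real B \<ge> real A" "real B > 0"
    using A BA by auto
  have rn: "real n = real B * real A + real r" using n by (metis of_nat_add of_nat_mult)
  have rr: "0 \<le> real r" "real r \<le> real A" using r by auto
  define HA HB where "HA = (harm A :: real)" and "HB = (harm B :: real)"
  have sumharm: "(\<Sum>a\<in>{1..K}. c / real a) = c * harm K" for c K
    unfolding harm_def by (simp add: sum_distrib_left divide_inverse)
  have "real (divisor_sum 2 n) = (\<Sum>a\<in>{1..A}. real (n div a)) + (\<Sum>b\<in>{1..B}. real (n div b) - real A)"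
  proof -
    have "real (n div b - A) = real (n div b) - real A" if "b \<in> {1..B}" for b
    proof -
      have "b * A \<le> n" using that A unfolding B_def by (auto simp: less_eq_div_iff_mult_less_eq)
      then have "A \<le> n div b" using that by (auto simp: less_eq_div_iff_mult_less_eq mult.commute)
      then show ?thesis by simp
    qed
    then show ?thesis using A by (subst sum_divisors_hyperbola[of A]) (auto simp: B_def)
  qed
  also have "(\<Sum>a\<in>{1..A}. real (n div a)) = (\<Sum>a\<in>{1..A}. real n / real a - 1 / 2 + (1 / 2) / real a + sawtooth a n)"
    by (intro sum.cong refl) (auto simp: real_div_eq_sawtooth)
  also have "\<dots> = real n * HA - real A / 2 + HA / 2 + (\<Sum>a\<in>{1..A}. sawtooth a n)"
    by (simp only: sum.distrib sum_subtractf sumharm HA_def) simp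
  also have "(\<Sum>b\<in>{1..B}. real (n div b) - real A) = (\<Sum>a\<in>{1..B}. real n / real a - 1 / 2 + (1 / 2) / real a + sawtooth a n - real A)"
    by (intro sum.cong refl) (auto simp: real_div_eq_sawtooth)
  also have "\<dots> = real n * HB - real B / 2 + HB / 2 + (\<Sum>a\<in>{1..B}. sawtooth a n) - real A * real B"
    by (simp only: sum.distrib sum_subtractf sumharm HB_def) simp
  finally have D: "real (divisor_sum 2 n) = real n * (HA + HB) - real A / 2 - real B / 2 - real A * real B
      + (HA + HB) / 2 + sawtooth_sum A n"
    by (simp add: sawtooth_sum_def B_def algebra_simps)
  define al be where "al = HA - ln (real A) - euler_mascheroni - 1 / (2 * real A)"
    and "be = HB - ln (real B) - euler_mascheroni - 1 / (2 * real B)"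
  have n8: "real n \<le> 8 * (real A)\<^sup>2" using A(3) by (metis of_nat_le_iff of_nat_mult of_nat_numeral of_nat_power)
  have nA2: "(real A)\<^sup>2 \<le> real n" using A(2) by (metis of_nat_le_iff of_nat_power)
  have al: "\<bar>al\<bar> \<le> 1 / (real A)\<^sup>2" unfolding al_def HA_def using A by (intro harm_approx) auto
  have "\<bar>be\<bar> \<le> 1 / (real B)\<^sup>2" unfolding be_def HB_def using BA A by (intro harm_approx) auto
  also have "\<dots> \<le> 1 / (real A)\<^sup>2"
    using Ap Bp by (intro divide_left_mono power_mono) auto
  finally have be: "\<bar>be\<bar> \<le> 1 / (real A)\<^sup>2" .
  have small: "\<bar>al + be\<bar> \<le> 2 * (1 / (real A)\<^sup>2)"
    using al be by linarith
  have e1: "\<bar>real n * (al + be)\<bar> \<le> 16"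
  proof -
    have "\<bar>real n * (al + be)\<bar> \<le> (8 * (real A)\<^sup>2) * (2 * (1 / (real A)\<^sup>2))"
      unfolding abs_mult using n8 small by (intro mult_mono) auto
    then show ?thesis using Ap by simp
  qed
  define x where "x = real r / real n"
  have "4 \<le> (real A)\<^sup>2" using power_mono[OF Ap(2), of 2] by simp
  then have "1 / (real A)\<^sup>2 \<le> 1 / 2" by (simp add: divide_simps)
  with small have small1: "\<bar>al + be\<bar> \<le> 1" by linarith
  have "2 * real A \<le> (real A)\<^sup>2" using Ap by (simp add: power2_eq_square)
  then have "real r \<le> (1 / 2) * real n" using rr nA2 by linarith
  then have x: "0 \<le> x" "x \<le> 1 / 2"
    unfolding x_def using np by (simp_all only: pos_divide_le_eq) simp
  have nx: "real n * x = real r" using np by (simp add: x_def)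
  have lnAB: "ln (real A) + ln (real B) = ln (real n) + ln (1 - x)"
  proof -
    have "1 - x > 0" using x by simp
    have "real n * (1 - x) = real n - real r" by (simp add: right_diff_distrib nx)
    then have "real A * real B = real n * (1 - x)" unfolding rn by (simp add: mult.commute)
    then have "ln (real A * real B) = ln (real n * (1 - x))" by simp
    then show ?thesis using ln_mult_pos[OF np \<open>1 - x > 0\<close>] ln_mult_pos[OF Ap(1) Bp(2)] by simp
  qed
  have ln1: "ln (1 - x) \<le> - x" "- x - 2 * x\<^sup>2 \<le> ln (1 - x)"
    using ln_add_one_self_le_self2[of "- x"] ln_one_minus_pos_lower_bound[of x] x by auto
  have nxx: "0 \<le> real n * x\<^sup>2" "real n * x\<^sup>2 \<le> 1"
  proof -
    have "real n * x\<^sup>2 = (real r)\<^sup>2 / real n" using np by (simp add: x_def power2_eq_square)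
    also have "\<dots> \<le> (real A)\<^sup>2 / real n" using rr by (intro divide_right_mono power_mono) auto
    also have "\<dots> \<le> 1" using nA2 np by simp
    finally show "real n * x\<^sup>2 \<le> 1" .
  qed auto
  define L where "L = ln (1 - x)"
  have e2: "real n * L \<le> - real r" "- real r - 2 \<le> real n * L"
  proof -
    have "real n * L \<le> real n * (- x)" unfolding L_def using ln1 by (intro mult_left_mono) auto
    then show "real n * L \<le> - real r" using nx by simp
    have "real n * (- x - 2 * x\<^sup>2) \<le> real n * L" unfolding L_def using ln1 by (intro mult_left_mono) auto
    then show "- real r - 2 \<le> real n * L" using nx nxx by (simp add: algebra_simps)
  qed
  have L1: "- 1 \<le> L" "L \<le> 0"
  proof -
    have "x\<^sup>2 \<le> (1 / 2)\<^sup>2" using x by (intro power_mono) auto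
    then have "x\<^sup>2 \<le> 1 / 4" by (simp add: power2_eq_square)
    then show "- 1 \<le> L" using ln1 x unfolding L_def by linarith
    show "L \<le> 0" using ln1 x unfolding L_def by linarith
  qed
  \<comment> \<open>The effect on \<open>n / (2 A)\<close> and \<open>n / (2 B)\<close> of replacing \<open>n\<close> by \<open>A * B\<close>, as \<open>L\<close> is its effect on \<open>ln n\<close>.\<close>
  define p q where "p = real r / (2 * real A)" and "q = real r / (2 * real B)"
  have pq: "0 \<le> p" "p \<le> 1 / 2" "0 \<le> q" "q \<le> 1 / 2"
    using rr Ap Bp by (auto simp: p_def q_def divide_simps)
  have e3: "real n / (2 * real A) = real B / 2 + p" "real n / (2 * real B) = real A / 2 + q"
    unfolding rn p_def q_def using Ap Bp by (auto simp: field_simps)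
  define iA iB where "iA = 1 / (2 * real A)" and "iB = 1 / (2 * real B)"
  have i: "0 \<le> iA" "iA \<le> 1 / 2" "0 \<le> iB" "iB \<le> 1 / 2"
    using Ap Bp by (auto simp: iA_def iB_def divide_simps)
  have H: "HA + HB = ln (real n) + L + 2 * euler_mascheroni + iA + iB + (al + be)"
    using lnAB by (simp add: al_def be_def L_def iA_def iB_def)
  have "real n * (HA + HB) = real n * ln (real n) + real n * L + 2 * euler_mascheroni * real n
      + real n / (2 * real A) + real n / (2 * real B) + real n * (al + be)"
    unfolding H by (simp add: iA_def iB_def algebra_simps)
  also have "\<dots> = real n * ln (real n) + real n * L + 2 * euler_mascheroni * real n
      + real B / 2 + p + real A / 2 + q + real n * (al + be)" by (simp add: e3)
  finally have nH: "real n * (HA + HB) = real n * ln (real n) + real n * L + 2 * euler_mascheroni * real n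
      + real B / 2 + p + real A / 2 + q + real n * (al + be)" .
  have g: "0 \<le> (euler_mascheroni::real)" "(euler_mascheroni::real) \<le> 1"
    using euler_mascheroni_pos euler_mascheroni_less_13_over_22 by auto
  define X Y W where "X = real n * (al + be)" and "Y = real n * L"
    and "W = L + 2 * euler_mascheroni + iA + iB + (al + be)"
  define E where "E = real (divisor_sum 2 n) - M - ln (real n) / 2 - sawtooth_sum A n"
  define P1 P2 P3 S Q where "P1 = real n * ln (real n)" and "P2 = 2 * euler_mascheroni * real n"
    and "P3 = real A * real B" and "S = HA + HB" and "Q = real n * (HA + HB)"
  have "M = P1 + P2 - real n"
    by (simp add: M_def P1_def P2_def algebra_simps)
  moreover have "P3 = real n - real r" using rn by (simp add: P3_def mult.commute)
  moreover have "S = ln (real n) + W" using H by (simp add: W_def S_def)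
  moreover have "real (divisor_sum 2 n) = Q - real A / 2 - real B / 2 - P3 + S / 2 + sawtooth_sum A n"
    using D by (simp only: P3_def S_def Q_def)
  moreover have "Q = P1 + Y + P2 + real B / 2 + p + real A / 2 + q + X"
    using nH by (simp only: P1_def P2_def Y_def X_def Q_def)
  ultimately have E: "E = Y + real r + p + q + X + W / 2"
    unfolding E_def by linarith
  have "- 2 \<le> W" "W \<le> 4" unfolding W_def using L1 g i small1 by linarith+
  moreover have "\<bar>X\<bar> \<le> 16" "- 2 \<le> Y + real r" "Y + real r \<le> 0"
    using e1 e2 by (simp_all add: X_def Y_def)
  ultimately have "\<bar>E\<bar> \<le> 20" using pq unfolding E by linarith
  then show ?thesis by (simp add: E_def)
qed

definition main2 :: "real \<Rightarrow> real" where
  "main2 x = x * ln x + (2 * euler_mascheroni - 1) * x"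

lemma main2_Suc_ge:
  assumes "n > 0"
  shows "main2 (real n) + ln (real n) \<le> main2 (real n + 1)"
proof -
  have n: "real n > 0" using assms by simp
  have "ln (real n / (real n + 1)) \<le> real n / (real n + 1) - 1"
    using n by (intro ln_le_minus_one) auto
  also have "\<dots> = - 1 / (real n + 1)" using n by (simp add: field_simps)
  finally have "ln (real n) + 1 / (real n + 1) \<le> ln (real n + 1)" using n by (simp add: ln_div)
  then have "(real n + 1) * (ln (real n) + 1 / (real n + 1)) \<le> (real n + 1) * ln (real n + 1)"
    using n by (intro mult_left_mono) auto
  also have "(real n + 1) * (ln (real n) + 1 / (real n + 1)) = (real n + 1) * ln (real n) + 1"
    using n by (simp add: field_simps)
  finally have "(real n + 1) * ln (real n) + 1 \<le> (real n + 1) * ln (real n + 1)" .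
  then show ?thesis using euler_mascheroni_pos by (simp add: main2_def algebra_simps)
qed

lemma divisor_sum_2_strict: "n > 0 \<Longrightarrow> divisor_sum 2 n < divisor_sum 2 (Suc n)"
proof -
  assume "n > 0"
  let ?X = "{(a, b). 0 < a \<and> 0 < b \<and> a * b = Suc n}"
  have "?X \<subseteq> {1..Suc n} \<times> {1..Suc n}"
  proof clarify
    fix a b assume ab: "0 < a" "0 < b" "a * b = Suc n"
    have "a dvd Suc n" "b dvd Suc n" using ab by (metis dvd_triv_left, metis dvd_triv_right)
    then show "a \<in> {1..Suc n} \<and> b \<in> {1..Suc n}" using ab by (auto dest: dvd_imp_le)
  qed
  then have "finite ?X" by (rule finite_subset) auto
  moreover have "(1, Suc n) \<in> ?X" by simp
  ultimately have "card ?X > 0" using card_gt_0_iff by blast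
  then have "num_factorizations 2 (Suc n) > 0" by (simp add: num_factorizations_2)
  then show ?thesis by (simp add: divisor_sum_def)
qed

text \<open>
  By the two preceding estimates the average of \<open>\<Delta>\<^sub>2(n)\<close> over \<open>n = N + u + v\<close> is \<open>ln N / 2\<close> up to a constant
  below \<open>111\<close>. Without a positive value it would be at most \<open>0\<close>. If the left limit of \<open>\<Delta>\<^sub>2\<close> at \<open>n + 1\<close>
  were never negative, then always \<open>\<Delta>\<^sub>2(n) \<ge> M\<^sub>2(n + 1) - M\<^sub>2(n) \<ge> ln n\<close>, so it would be at least \<open>ln N\<close>.
\<close>

lemma divisor_error_2_both_signs:
  fixes A N h :: nat
  assumes A: "A \<ge> 2" "A\<^sup>2 \<le> N" "N \<le> 4 * A\<^sup>2" and h: "A ^ 3 \<le> h\<^sup>2" "2 * h \<le> N"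
    and N: "ln (real N) \<ge> 222"
  shows "\<exists>n\<ge>N. n < N + 2 * h \<and> main2 (real n) < real (divisor_sum 2 n)"
    and "\<exists>n\<ge>N. n < N + 2 * h \<and> real (divisor_sum 2 n) < main2 (real n + 1)"
proof -
  define F where "F = (\<lambda>n. real (divisor_sum 2 n) - main2 (real n))"
  have mean: "\<bar>\<Sum>u<h. \<Sum>v<h. sawtooth_sum A (N + u + v)\<bar> \<le> 89 * (real h)\<^sup>2"
    using A h by (intro double_sum_sawtooth_sum_le) auto
  have "0 < A ^ 3" using A by simp
  then have "h > 0" using h(1) by (cases h) auto
  then have h2: "(real h)\<^sup>2 > 0" by simp
  have Np: "N > 0" using h(2) \<open>h > 0\<close> by linarith
  have approx: "\<bar>F n - ln (real n) / 2 - sawtooth_sum A n\<bar> \<le> 20" "ln (real N) \<le> ln (real n)" "ln (real n) \<le> ln (real N) + 1"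
    if n: "N \<le> n" "n < N + 2 * h" for n
  proof -
    have n2: "n \<le> 2 * N" using n h by linarith
    then have "\<bar>real (divisor_sum 2 n) - main2 (real n) - ln (real n) / 2 - sawtooth_sum A n\<bar> \<le> 20"
      unfolding main2_def using A n by (intro divisor_sum_2_approx) auto
    then show "\<bar>F n - ln (real n) / 2 - sawtooth_sum A n\<bar> \<le> 20" by (simp add: F_def)
    show "ln (real N) \<le> ln (real n)" using n Np by simp
    have "ln (real n) \<le> ln (2 * real N)" using n2 n Np by (subst ln_le_cancel_iff) auto
    also have "\<dots> = ln 2 + ln (real N)" using Np by (intro ln_mult_pos) auto
    finally show "ln (real n) \<le> ln (real N) + 1" using ln_2_less_1 by linarith
  qed
  show "\<exists>n\<ge>N. n < N + 2 * h \<and> main2 (real n) < real (divisor_sum 2 n)"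
  proof (rule ccontr)
    assume neg: "\<not> ?thesis"
    have "(\<Sum>u<h. \<Sum>v<h. sawtooth_sum A (N + u + v)) \<le> (\<Sum>u<h. \<Sum>v<h. - 90)"
    proof (intro sum_mono)
      fix u v assume uv: "u \<in> {..<h}" "v \<in> {..<h}"
      then have n: "N \<le> N + u + v" "N + u + v < N + 2 * h" by auto
      have "F (N + u + v) \<le> 0" using neg n unfolding F_def by (metis diff_le_0_iff_le not_le)
      with approx[OF n] N show "sawtooth_sum A (N + u + v) \<le> - 90" by linarith
    qed
    also have "\<dots> = - 90 * (real h)\<^sup>2" by (simp add: power2_eq_square)
    finally show False using mean h2 by linarith
  qed
  show "\<exists>n\<ge>N. n < N + 2 * h \<and> real (divisor_sum 2 n) < main2 (real n + 1)"
  proof (rule ccontr)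
    assume neg: "\<not> ?thesis"
    have "(\<Sum>u<h. \<Sum>v<h. 90) \<le> (\<Sum>u<h. \<Sum>v<h. sawtooth_sum A (N + u + v))"
    proof (intro sum_mono)
      fix u v assume uv: "u \<in> {..<h}" "v \<in> {..<h}"
      then have n: "N \<le> N + u + v" "N + u + v < N + 2 * h" by auto
      have "main2 (real (N + u + v) + 1) \<le> real (divisor_sum 2 (N + u + v))"
        using neg n by (metis not_le)
      moreover have "main2 (real (N + u + v)) + ln (real (N + u + v)) \<le> main2 (real (N + u + v) + 1)"
        using Np by (intro main2_Suc_ge) auto
      ultimately have "ln (real (N + u + v)) \<le> F (N + u + v)" unfolding F_def by linarith
      with approx[OF n] N show "90 \<le> sawtooth_sum A (N + u + v)" by linarith
    qed
    moreover have "(\<Sum>u<h. \<Sum>v<h. 90) = 90 * (real h)\<^sup>2" by (simp add: power2_eq_square)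
    ultimately show False using mean h2 by linarith
  qed
qed

lemma divisor_error_2_both_signs_eventually:
  "\<forall>\<^sub>F N in sequentially.
     (\<exists>n\<ge>N. real n \<le> real N + 4 * real N powr (3 / 4) \<and> main2 (real n) < real (divisor_sum 2 n)) \<and>
     (\<exists>n\<ge>N. real n \<le> real N + 4 * real N powr (3 / 4) \<and> real (divisor_sum 2 n) < main2 (real n + 1))"
proof -
  have "\<forall>\<^sub>F N :: nat in sequentially. ln (real N) \<ge> 222" by real_asymp
  moreover have "\<forall>\<^sub>F N :: nat in sequentially. 4 * real N powr (3 / 4) \<le> real N" by real_asymp
  moreover have "\<forall>\<^sub>F N :: nat in sequentially. N \<ge> 4" by (rule eventually_ge_at_top)
  ultimately show ?thesis
  proof eventually_elim
    case (elim N)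
    define A where "A = nat \<lfloor>sqrt (real N)\<rfloor>"
    define h where "h = nat \<lceil>real N powr (3 / 4)\<rceil>"
    have "2 \<le> sqrt (real N)" using elim(3) by (intro real_le_rsqrt) auto
    then have A2: "A \<ge> 2" by (simp add: A_def le_nat_iff le_floor_iff)
    have Aub: "real A \<le> sqrt (real N)" by (simp add: A_def)
    have "(real A)\<^sup>2 \<le> (sqrt (real N))\<^sup>2" using Aub by (intro power_mono) auto
    then have "real (A\<^sup>2) \<le> real N" by simp
    then have AN: "A\<^sup>2 \<le> N" by (simp only: of_nat_le_iff)
    have "sqrt (real N) \<le> real A + 1" unfolding A_def by linarith
    also have "\<dots> \<le> 2 * real A" using A2 by simp
    finally have "(sqrt (real N))\<^sup>2 \<le> (2 * real A)\<^sup>2" by (intro power_mono) auto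
    then have "real N \<le> real (4 * A\<^sup>2)" by (simp add: power_mult_distrib)
    then have NA: "N \<le> 4 * A\<^sup>2" by (simp only: of_nat_le_iff)
    define y where "y = real N powr (3 / 4)"
    have y1: "y \<ge> 1" unfolding y_def using elim(3) by (intro ge_one_powr_ge_zero) auto
    have hy: "y \<le> real h" "real h \<le> y + 1" using y1 by (auto simp: h_def y_def)
    have "real A ^ 3 \<le> sqrt (real N) ^ 3" using Aub by (intro power_mono) auto
    also have "\<dots> = y\<^sup>2"
      using elim(3) by (simp add: y_def powr_half_sqrt[symmetric] powr_power)
    also have "\<dots> \<le> (real h)\<^sup>2" using hy y1 by (intro power_mono) auto
    finally have "real (A ^ 3) \<le> real (h\<^sup>2)" by simp
    then have Ah: "A ^ 3 \<le> h\<^sup>2" by (simp only: of_nat_le_iff)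
    have h4: "2 * real h \<le> 4 * y" using hy y1 by linarith
    then have "real (2 * h) \<le> real N" using elim(2) by (simp add: y_def)
    then have hN: "2 * h \<le> N" by (simp only: of_nat_le_iff)
    have win: "real n \<le> real N + 4 * real N powr (3 / 4)" if "n < N + 2 * h" for n
      using that h4 unfolding y_def by linarith
    show ?case
      using divisor_error_2_both_signs[OF A2 AN NA Ah hN elim(1)] win by blast
  qed
qed

text \<open>
  Take the first \<open>n \<ge> n1\<close> whose unit interval ends with a negative value of \<open>\<Delta>\<^sub>2\<close>. If \<open>n > n1\<close>, the
  previous unit interval ends with a nonnegative value, which the jump at \<open>n\<close> makes positive.
\<close>

lemma downward_crossing:
  assumes "n1 > 0" "n1 \<le> n2" "main2 (real n1) < real (divisor_sum 2 n1)"
    "real (divisor_sum 2 n2) < main2 (real n2 + 1)"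
  obtains n where "n1 \<le> n" "n \<le> n2" "main2 (real n) < real (divisor_sum 2 n)"
    "real (divisor_sum 2 n) < main2 (real n + 1)"
proof -
  define n where "n = (LEAST n. n1 \<le> n \<and> real (divisor_sum 2 n) < main2 (real n + 1))"
  have n: "n1 \<le> n" "real (divisor_sum 2 n) < main2 (real n + 1)"
    using LeastI[of "\<lambda>n. n1 \<le> n \<and> real (divisor_sum 2 n) < main2 (real n + 1)" n2] assms
    unfolding n_def by auto
  have n2: "n \<le> n2" unfolding n_def by (rule Least_le) (use assms in auto)
  have "main2 (real n) < real (divisor_sum 2 n)"
  proof (cases "n = n1")
    case False
    then obtain k where k: "n = Suc k" "n1 \<le> k" using n(1) by (cases n) auto
    then have "\<not> real (divisor_sum 2 k) < main2 (real k + 1)"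
      using not_less_Least[of k "\<lambda>n. n1 \<le> n \<and> real (divisor_sum 2 n) < main2 (real n + 1)"]
      unfolding n_def[symmetric] by auto
    moreover have "divisor_sum 2 k < divisor_sum 2 n"
      using k assms(1) divisor_sum_2_strict[of k] by simp
    ultimately show ?thesis using k(1) by (simp add: add.commute)
  qed (use assms in auto)
  with n n2 that show thesis by blast
qed

text \<open>
  The interval contains \<open>k\<close> disjoint windows of length about \<open>T powr (4 / 5)\<close>, and each of these has room
  for two successive windows of the kind treated above: one for a positive value and, after it, one for a
  negative value.
\<close>

lemma many_downward_crossings:
  fixes k :: nat
  shows "\<forall>\<^sub>F T :: real in at_top. \<exists>S. finite S \<and> card S = k \<and>
     (\<forall>n\<in>S. T \<le> real n \<and> real n + 1 \<le> T + T powr (9 / 10) \<and>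
        main2 (real n) < real (divisor_sum 2 n) \<and> real (divisor_sum 2 n) < main2 (real n + 1))"
proof -
  define good where "good = (\<lambda>n. main2 (real n) < real (divisor_sum 2 n) \<and> real (divisor_sum 2 n) < main2 (real n + 1))"
  obtain N0 where N0: "\<And>N. N \<ge> N0 \<Longrightarrow>
     (\<exists>n\<ge>N. real n \<le> real N + 4 * real N powr (3 / 4) \<and> main2 (real n) < real (divisor_sum 2 n)) \<and>
     (\<exists>n\<ge>N. real n \<le> real N + 4 * real N powr (3 / 4) \<and> real (divisor_sum 2 n) < main2 (real n + 1))"
    using divisor_error_2_both_signs_eventually unfolding eventually_sequentially by blast
  have "\<forall>\<^sub>F T :: real in at_top. T \<ge> real N0 + 1" by (rule eventually_ge_at_top)
  \<comment> \<open>With \<open>T powr (1 / 20)\<close> in place of \<open>k\<close> all conditions become inequalities in \<open>T\<close> alone.\<close>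
  moreover have "\<forall>\<^sub>F T :: real in at_top. real k \<le> T powr (1 / 20)"
    using filterlim_at_top by (metis real_powr_at_top zero_less_divide_1_iff zero_less_numeral)
  moreover have "\<forall>\<^sub>F T :: real in at_top. T powr (1 / 20) * (T powr (4 / 5) + 1) + 3 \<le> T powr (9 / 10)" by real_asymp
  moreover have "\<forall>\<^sub>F T :: real in at_top. T powr (9 / 10) \<le> T" by real_asymp
  moreover have "\<forall>\<^sub>F T :: real in at_top. 8 * (4 * T) powr (3 / 4) + 3 \<le> T powr (4 / 5)" by real_asymp
  moreover have "\<forall>\<^sub>F T :: real in at_top. T powr (4 / 5) \<le> T" by real_asymp
  ultimately show ?thesis
  proof eventually_elim
    case (elim T)
    have T: "T \<ge> 1" using elim(1) by simp
    define L where "L = nat \<lceil>T powr (4 / 5)\<rceil>"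
    define M where "M = nat \<lceil>T\<rceil>"
    have L: "T powr (4 / 5) \<le> real L" "real L \<le> T powr (4 / 5) + 1"
      by (auto simp: L_def)
    have M: "T \<le> real M" "real M \<le> T + 1" using T by (auto simp: M_def)
    have cross: "\<exists>n. N \<le> n \<and> n < N + L \<and> good n" if N: "T \<le> real N" "real N \<le> 2 * T" for N
    proof -
      have "N \<ge> N0" using N elim(1) by linarith
      from N0[OF this] obtain n1 where n1: "N \<le> n1" "real n1 \<le> real N + 4 * real N powr (3 / 4)"
        "main2 (real n1) < real (divisor_sum 2 n1)" by blast
      define w where "w = (4 * T) powr (3 / 4)"
      have "real N powr (3 / 4) \<le> w" unfolding w_def using N T by (intro powr_mono2) auto
      then have n1w: "real n1 \<le> real N + 4 * w" using n1 by linarith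
      have w0: "w \<ge> 0" by (simp add: w_def)
      have wT: "8 * w + 3 \<le> T powr (4 / 5)" "8 * w + 3 \<le> T" using elim(5,6) by (auto simp: w_def)
      have "n1 \<ge> N0" using n1 \<open>N \<ge> N0\<close> by linarith
      from N0[OF this] obtain n2 where n2: "n1 \<le> n2" "real n2 \<le> real n1 + 4 * real n1 powr (3 / 4)"
        "real (divisor_sum 2 n2) < main2 (real n2 + 1)" by blast
      have "real n1 \<le> 4 * T" using n1w N wT w0 T by linarith
      then have "real n1 powr (3 / 4) \<le> w" unfolding w_def using N T by (intro powr_mono2) auto
      then have "real n2 \<le> real N + 8 * w" using n2 n1w by linarith
      then have "real n2 < real N + real L" using wT L by linarith
      then have "n2 < N + L" by linarith
      moreover have "n1 > 0" using n1 N T by linarith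
      ultimately show ?thesis
        using downward_crossing[OF \<open>n1 > 0\<close> n2(1) n1(3) n2(3)] n1(1)
        unfolding good_def by (metis le_less_trans le_trans)
    qed
    have kL: "real k * real L + 3 \<le> T powr (9 / 10)"
    proof -
      have "real k * real L \<le> T powr (1 / 20) * (T powr (4 / 5) + 1)"
        using elim(2) L by (intro mult_mono) auto
      with elim(3) show ?thesis by linarith
    qed
    have "\<exists>n. M + i * L \<le> n \<and> n < M + i * L + L \<and> good n" if i: "i < k" for i
    proof (rule cross)
      show "T \<le> real (M + i * L)" using M by (simp add: add_increasing2)
      have "real (i * L) \<le> real k * real L" unfolding of_nat_mult using i by (intro mult_right_mono) auto
      then show "real (M + i * L) \<le> 2 * T" using M kL elim(4) by simp
    qed
    then obtain c where c: "\<And>i. i < k \<Longrightarrow> M + i * L \<le> c i \<and> c i < M + i * L + L \<and> good (c i)"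
      by metis
    have "c i < c j" if "i < j" "j < k" for i j
    proof -
      have "Suc i * L \<le> j * L" using that by (intro mult_le_mono1) auto
      then show ?thesis using c[of i] c[of j] that by simp
    qed
    then have "inj_on c {..<k}" by (auto simp: inj_on_def) (metis linorder_neqE_nat less_irrefl)
    then have "card (c ` {..<k}) = k" by (simp add: card_image)
    moreover have "T \<le> real n \<and> real n + 1 \<le> T + T powr (9 / 10) \<and> good n" if n: "n \<in> c ` {..<k}" for n
    proof -
      from n obtain i where i: "i < k" "n = c i" by auto
      have "Suc i * L \<le> k * L" using i by (intro mult_le_mono1) auto
      then have "n < M + k * L" "M \<le> n" using c[OF i(1)] i(2) by auto
      then have "real n < real M + real k * real L" by (metis of_nat_add of_nat_less_iff of_nat_mult)
      then show ?thesis using M kL c[OF i(1)] i(2) \<open>M \<le> n\<close> by simp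
    qed
    ultimately show ?case unfolding good_def by (intro exI[of _ "c ` {..<k}"]) auto
  qed
qed

section \<open>Sign changes of the product\<close>

text \<open>
  The integrand is \<open>A(s) x\<^sup>s / (s - 1)\<^sup>3\<close> with \<open>A\<close> holomorphic and \<open>A 1 = 1\<close>, so the residue is half the second
  derivative of \<open>A(s) x\<^sup>s\<close> at \<open>1\<close>: a quadratic polynomial in \<open>ln x\<close> times \<open>x\<close>, with leading coefficient
  \<open>A 1 / 2\<close>.
\<close>

lemma divisor_main_term_3:
  obtains c0 c1 :: real
  where "\<And>x. x > 0 \<Longrightarrow> divisor_main_term 3 x = x * ((ln x)\<^sup>2 / 2 + c1 * ln x + c0)"
proof -
  obtain F where F: "F holomorphic_on {s. Re s > 0}" "F 1 = 1"
    "\<And>s. Re s > 0 \<Longrightarrow> s \<noteq> 1 \<Longrightarrow> zeta s = F s / (s - 1)" by (rule zeta_cases) blast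
  define U where "U = {s. Re s > 0}"
  have opU: "open U" unfolding U_def by (rule open_halfspace_Re_gt)
  have one: "1 \<in> U" by (simp add: U_def)
  define A where "A = (\<lambda>s. F s ^ 3 / s)"
  have holA: "A holomorphic_on U" unfolding A_def U_def by (intro holomorphic_intros F(1)) auto
  have holA': "deriv A holomorphic_on U" by (rule holomorphic_deriv[OF holA opU])
  have A1: "A 1 = 1" by (simp add: A_def F)
  show thesis
  proof (rule that[of "Re (deriv A 1)" "Re (deriv (deriv A) 1) / 2"])
    fix x :: real assume x: "x > 0"
    define l :: complex where "l = of_real (ln x)"
    have Lnx: "Ln (of_real x) = l" using x by (simp add: l_def Ln_of_real)
    define G where "G = (\<lambda>s. A s * of_real x powr s)"
    define G' where "G' = (\<lambda>s. (deriv A s + A s * l) * of_real x powr s)"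
    have dA: "(A has_field_derivative deriv A s) (at s)" if "s \<in> U" for s
      by (rule holomorphic_derivI[OF holA opU that])
    have dA': "(deriv A has_field_derivative deriv (deriv A) s) (at s)" if "s \<in> U" for s
      by (rule holomorphic_derivI[OF holA' opU that])
    have holG: "G holomorphic_on U" unfolding G_def using x by (intro holomorphic_intros holA) auto
    have dG: "(G has_field_derivative G' s) (at s)" if "s \<in> U" for s
      unfolding G_def G'_def using x Lnx
      by (auto intro!: derivative_eq_intros dA[OF that] simp: algebra_simps)
    have dG1: "(G' has_field_derivative of_real x * (deriv (deriv A) 1 + 2 * deriv A 1 * l + l\<^sup>2)) (at 1)"
      unfolding G'_def using x Lnx A1
      by (auto intro!: derivative_eq_intros dA[OF one] dA'[OF one] simp: algebra_simps power2_eq_square)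
    have "(deriv G has_field_derivative of_real x * (deriv (deriv A) 1 + 2 * deriv A 1 * l + l\<^sup>2)) (at 1)"
      by (rule has_field_derivative_transform_within_open[OF dG1 opU one])
         (use dG in \<open>auto intro: DERIV_imp_deriv[symmetric]\<close>)
    then have d2: "deriv (deriv G) 1 = of_real x * (deriv (deriv A) 1 + 2 * deriv A 1 * l + l\<^sup>2)"
      by (rule DERIV_imp_deriv)
    have "residue (\<lambda>s. zeta s ^ 3 * of_real x powr s / s) 1 = residue (\<lambda>s. G s / (s - 1) ^ Suc 2) 1"
    proof (rule residue_cong)
      have "\<forall>\<^sub>F s in nhds 1. s \<in> U" by (rule eventually_nhds_in_open[OF opU one])
      then have "\<forall>\<^sub>F s in at 1. s \<in> U \<and> s \<noteq> 1"
        by (auto simp: eventually_at_filter elim: eventually_mono)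
      then show "\<forall>\<^sub>F s in at 1. zeta s ^ 3 * of_real x powr s / s = G s / (s - 1) ^ Suc 2"
        by eventually_elim (auto simp: F(3) U_def G_def A_def power_divide eval_nat_numeral)
    qed simp
    also have "\<dots> = (deriv ^^ 2) G 1 / fact 2"
      by (rule residue_holomorphic_over_power[OF opU one holG])
    also have "\<dots> = of_real x * (deriv (deriv A) 1 + 2 * deriv A 1 * l + l\<^sup>2) / 2"
      using d2 by (simp add: eval_nat_numeral)
    finally have "divisor_main_term 3 x = Re (of_real x * (deriv (deriv A) 1 + 2 * deriv A 1 * l + l\<^sup>2) / 2)"
      unfolding divisor_main_term_def by (simp only:)
    also have "\<dots> = x * ((ln x)\<^sup>2 / 2 + Re (deriv A 1) * ln x + Re (deriv (deriv A) 1) / 2)"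
      by (simp add: l_def power2_eq_square algebra_simps add_divide_distrib)
    finally show "divisor_main_term 3 x = x * ((ln x)\<^sup>2 / 2 + Re (deriv A 1) * ln x + Re (deriv (deriv A) 1) / 2)" .
  qed
qed

lemma main_term_3_increasing:
  fixes c0 c1 :: real
  defines "M \<equiv> \<lambda>x. x * ((ln x)\<^sup>2 / 2 + c1 * ln x + c0)"
  shows "\<forall>\<^sub>F T in at_top. T > 0 \<and> (\<forall>x y. T \<le> x \<longrightarrow> x < y \<longrightarrow> M x < M y)"
proof -
  have "filterlim (\<lambda>x :: real. (ln x)\<^sup>2 / 2 + (c1 + 1) * ln x + (c0 + c1)) at_top at_top" by real_asymp
  then have "\<forall>\<^sub>F x in at_top. (ln x)\<^sup>2 / 2 + (c1 + 1) * ln x + (c0 + c1) > 0"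
    unfolding filterlim_at_top_dense by blast
  then obtain x0 where x0: "\<And>x. x \<ge> x0 \<Longrightarrow> (ln x)\<^sup>2 / 2 + (c1 + 1) * ln x + (c0 + c1) > 0"
    unfolding eventually_at_top_linorder by blast
  have "M x < M y" if "T \<ge> max 1 x0" "T \<le> x" "x < y" for T x y
  proof (rule DERIV_pos_imp_increasing[OF that(3)])
    fix z assume z: "x \<le> z" "z \<le> y"
    have "(M has_real_derivative ((ln z)\<^sup>2 / 2 + (c1 + 1) * ln z + (c0 + c1))) (at z)"
      unfolding M_def using z that
      by (auto intro!: derivative_eq_intros simp: field_simps power2_eq_square)
    then show "\<exists>d. (M has_real_derivative d) (at z) \<and> 0 < d" using x0[of z] z that by fastforce
  qed
  then have "\<forall>T\<ge>max 1 x0. T > 0 \<and> (\<forall>x y. T \<le> x \<longrightarrow> x < y \<longrightarrow> M x < M y)" by fastforce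
  then show ?thesis unfolding eventually_at_top_linorder by blast
qed

lemma main2_increasing:
  assumes "1 \<le> x" "x < y"
  shows "main2 x < main2 y"
proof (rule DERIV_pos_imp_increasing[OF assms(2)])
  fix z assume z: "x \<le> z" "z \<le> y"
  have "(main2 has_real_derivative ln z + 2 * euler_mascheroni) (at z)"
    unfolding main2_def using z assms by (auto intro!: derivative_eq_intros simp: algebra_simps)
  moreover have "0 < ln z + 2 * euler_mascheroni"
    using z assms euler_mascheroni_pos ln_ge_zero[of z] by linarith
  ultimately show "\<exists>d. (main2 has_real_derivative d) (at z) \<and> 0 < d" by blast
qed

lemma divisor_error_on_unit_interval:
  assumes "real n \<le> x" "x < real n + 1"
  shows "divisor_error k x = real (divisor_sum k n) - divisor_main_term k x"
proof -
  have "\<lfloor>x\<rfloor> = int n" using assms by linarith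
  then show ?thesis by (simp add: divisor_error_def divisor_sum_def)
qed

text \<open>
  With \<open>t\<close> the zero of \<open>\<Delta>\<^sub>2\<close> in the unit interval, \<open>\<Delta>\<^sub>2\<close> is positive on its left and negative on its right.
  As \<open>\<Delta>\<^sub>3\<close> decreases there, it is larger than \<open>\<Delta>\<^sub>3(t)\<close> on the left and smaller on the right, so the product
  is positive on the left if \<open>\<Delta>\<^sub>3(t) \<ge> 0\<close> and on the right otherwise. If \<open>\<Delta>\<^sub>3(t) \<noteq> 0\<close>, then by continuity
  the product is negative close to \<open>t\<close> on the other side.
\<close>

lemma sign_change_at_crossing:
  fixes n :: nat
  assumes n: "n \<ge> 1" and cross: "main2 (real n) < real (divisor_sum 2 n)" "real (divisor_sum 2 n) < main2 (real n + 1)"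
    and cont: "continuous_on {real n..real n + 1} (divisor_main_term 3)"
    and incr: "\<And>x y. real n \<le> x \<Longrightarrow> x < y \<Longrightarrow> divisor_main_term 3 x < divisor_main_term 3 y"
  defines "f \<equiv> \<lambda>x. divisor_error 2 x * divisor_error 3 x"
  shows "\<exists>x\<in>{real n<..<real n + 1}. f x > 0"
    and "(\<exists>x\<in>{real n<..<real n + 1}. f x < 0) \<or>
      (\<exists>t\<in>{real n<..<real n + 1}. main2 t \<in> \<int> \<and> divisor_main_term 3 t \<in> \<int>)"
proof -
  have "continuous_on {real n..real n + 1} main2"
    unfolding main2_def using n by (intro continuous_intros) auto
  with cross obtain t where t: "real n \<le> t" "t \<le> real n + 1" "main2 t = real (divisor_sum 2 n)"
    using IVT'[of main2 "real n" "real (divisor_sum 2 n)" "real n + 1"] by (auto intro: less_imp_le)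
  have tn: "real n < t" "t < real n + 1" using t cross by (auto simp: order_le_less)
  define g where "g = (\<lambda>x. real (divisor_sum 3 n) - divisor_main_term 3 x)"
  have f: "f x = (main2 t - main2 x) * g x" if "real n \<le> x" "x < real n + 1" for x
  proof -
    have "x > 0" using that n by linarith
    then have "divisor_main_term 2 x = main2 x" by (simp add: divisor_main_term_2 main2_def)
    then show ?thesis unfolding f_def g_def using that t(3) by (simp add: divisor_error_on_unit_interval)
  qed
  have left: "main2 t - main2 x > 0" if "real n \<le> x" "x < t" for x
    using main2_increasing[of x t] that n by simp
  have right: "main2 t - main2 x < 0" if "t < x" for x
    using main2_increasing[of t x] that n tn by simp
  have gdec: "g y < g x" if "real n \<le> x" "x < y" for x y using incr[OF that] by (simp add: g_def)
  have gt: "(g \<longlongrightarrow> g t) (at t)"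
  proof -
    have "continuous_on {real n..real n + 1} g" unfolding g_def by (intro continuous_intros cont)
    then have "isCont g t" by (rule continuous_on_interior) (use tn in auto)
    then show ?thesis by (simp add: isCont_def)
  qed
  obtain xl where xl: "real n < xl" "xl < t" using dense[OF tn(1)] by blast
  obtain xr where xr: "t < xr" "xr < real n + 1" using dense[OF tn(2)] by blast
  show "\<exists>x\<in>{real n<..<real n + 1}. f x > 0"
  proof (cases "g t \<ge> 0")
    case True
    then have "g xl > 0" using gdec[of xl t] xl by simp
    then have "f xl > 0" using f[of xl] left[of xl] xl tn by simp
    then show ?thesis using xl tn by (intro bexI[of _ xl]) auto
  next
    case False
    then have "g xr < 0" using gdec[of t xr] xr tn by simp
    then have "f xr > 0" using f[of xr] right[of xr] xr tn by (simp add: mult_neg_neg)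
    then show ?thesis using xr tn by (intro bexI[of _ xr]) auto
  qed
  show "(\<exists>x\<in>{real n<..<real n + 1}. f x < 0) \<or>
      (\<exists>t\<in>{real n<..<real n + 1}. main2 t \<in> \<int> \<and> divisor_main_term 3 t \<in> \<int>)"
  proof (cases "g t = 0")
    case True
    then have "divisor_main_term 3 t = real (divisor_sum 3 n)" by (simp add: g_def)
    then have "main2 t \<in> \<int> \<and> divisor_main_term 3 t \<in> \<int>" using t(3) by simp
    then show ?thesis using tn by auto
  next
    case False
    have "\<exists>x\<in>{real n<..<real n + 1}. f x < 0"
    proof (cases "g t > 0")
      case True
      then have "\<forall>\<^sub>F x in at_right t. g x > 0"
        using order_tendstoD(1)[OF tendsto_mono[OF at_le gt]] by auto
      moreover have "\<forall>\<^sub>F x in at_right t. x \<in> {t<..<real n + 1}"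
        using tn by (intro eventually_at_right_real)
      ultimately have "\<exists>x. g x > 0 \<and> x \<in> {t<..<real n + 1}"
        using eventually_happens[OF eventually_conj] by force
      then obtain x where x: "g x > 0" "t < x" "x < real n + 1" by auto
      then have "f x < 0" using f[of x] right[of x] tn by (simp add: mult_neg_pos)
      then show ?thesis using x tn by (intro bexI[of _ x]) auto
    next
      case False
      then have "g t < 0" using \<open>g t \<noteq> 0\<close> by simp
      then have "\<forall>\<^sub>F x in at_left t. g x < 0"
        using order_tendstoD(2)[OF tendsto_mono[OF at_le gt]] by auto
      moreover have "\<forall>\<^sub>F x in at_left t. x \<in> {real n<..<t}"
        using tn by (intro eventually_at_left_real)
      ultimately have "\<exists>x. g x < 0 \<and> x \<in> {real n<..<t}"
        using eventually_happens[OF eventually_conj] by force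
      then obtain x where x: "g x < 0" "real n < x" "x < t" by auto
      then have "f x < 0" using f[of x] left[of x] tn by (simp add: mult_pos_neg)
      then show ?thesis using x tn by (intro bexI[of _ x]) auto
    qed
    then show ?thesis ..
  qed
qed


theorem theorem1:
  fixes \<epsilon> :: real
  assumes "\<epsilon> > 0"
  shows "\<exists>T0\<ge>1. \<forall>T\<ge>T0.
           changes_sign_on (\<lambda>x. divisor_error 2 x * divisor_error 3 x)
             {T..T + T powr (139 / 144 + \<epsilon>)}"
proof -
  obtain c0 c1 where c: "\<And>x. x > 0 \<Longrightarrow> divisor_main_term 3 x = x * ((ln x)\<^sup>2 / 2 + c1 * ln x + c0)"
    by (rule divisor_main_term_3) blast
  define M3 where "M3 = (\<lambda>x. x * ((ln x)\<^sup>2 / 2 + c1 * ln x + c0))"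
  obtain k :: nat where few: "\<forall>\<^sub>F T in at_top. \<forall>S. finite S \<longrightarrow> S \<subseteq> {T..T + T powr (9 / 10)} \<longrightarrow>
     (\<forall>x\<in>S. main2 x \<in> \<int> \<and> M3 x \<in> \<int>) \<longrightarrow> card S < k"
  proof -
    have m2: "main2 x = x * (ln x + (2 * euler_mascheroni - 1))" for x
      by (simp add: main2_def algebra_simps)
    \<comment> \<open>The degree \<open>m = 400\<close> satisfies the condition: \<open>3202 * 64060 = 205120120 < 256000000 = 4 * 400\<^sup>3\<close>.\<close>
    show thesis
      by (rule that[of "6 * 400\<^sup>2"], unfold m2 M3_def,
          rule common_integer_values_bounded[where J = 64060]) simp_all
  qed
  have incr: "\<forall>\<^sub>F T in at_top. T > 0 \<and> (\<forall>x y. T \<le> x \<longrightarrow> x < y \<longrightarrow> M3 x < M3 y)"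
    unfolding M3_def by (rule main_term_3_increasing)
  have "\<forall>\<^sub>F T in at_top. T \<ge> 1 \<and> changes_sign_on (\<lambda>x. divisor_error 2 x * divisor_error 3 x)
             {T..T + T powr (139 / 144 + \<epsilon>)}"
    using few incr many_downward_crossings[of "Suc k"] eventually_ge_at_top[of 1]
  proof eventually_elim
    case (elim T)
    define f where "f = (\<lambda>x. divisor_error 2 x * divisor_error 3 x)"
    define I where "I = {T..T + T powr (9 / 10)}"
    obtain S where S: "finite S" "card S = Suc k"
      "\<And>n. n \<in> S \<Longrightarrow> T \<le> real n" "\<And>n. n \<in> S \<Longrightarrow> real n + 1 \<le> T + T powr (9 / 10)"
      "\<And>n. n \<in> S \<Longrightarrow> main2 (real n) < real (divisor_sum 2 n)"
      "\<And>n. n \<in> S \<Longrightarrow> real (divisor_sum 2 n) < main2 (real n + 1)"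
      using elim(3) by blast
    have M3: "divisor_main_term 3 x = M3 x" if "T \<le> x" for x
      using c[of x] that elim(4) by (simp add: M3_def)
    have sub: "{real n<..<real n + 1} \<subseteq> I" if "n \<in> S" for n
      using S(3,4)[OF that] by (auto simp: I_def)
    have cont: "continuous_on {real n..real n + 1} (divisor_main_term 3)" if "n \<in> S" for n
    proof -
      have "continuous_on {real n..real n + 1} M3"
        unfolding M3_def using S(3)[OF that] elim(4) by (intro continuous_intros) auto
      then show ?thesis by (rule continuous_on_eq) (use S(3)[OF that] M3 in auto)
    qed
    have mono: "divisor_main_term 3 x < divisor_main_term 3 y" if "n \<in> S" "real n \<le> x" "x < y" for n x y
      using elim(2) S(3)[OF that(1)] that M3 by simp
    have n1: "n \<ge> 1" if "n \<in> S" for n using S(3)[OF that] elim(4) by simp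
    have local_pos: "\<exists>x\<in>{real n<..<real n + 1}. f x > 0"
      and local_neg: "(\<exists>x\<in>{real n<..<real n + 1}. f x < 0) \<or>
        (\<exists>t\<in>{real n<..<real n + 1}. main2 t \<in> \<int> \<and> divisor_main_term 3 t \<in> \<int>)"
      if n: "n \<in> S" for n
      unfolding f_def
      using sign_change_at_crossing[OF n1[OF n] S(5)[OF n] S(6)[OF n] cont[OF n] mono[OF n]] by simp_all
    obtain n0 where n0: "n0 \<in> S" using S(2) by fastforce
    have pos: "\<exists>x\<in>I. f x > 0" using local_pos[OF n0] sub[OF n0] by blast
    have neg: "\<exists>x\<in>I. f x < 0"
    proof (rule ccontr)
      assume none: "\<not> ?thesis"
      have "\<exists>t\<in>{real n<..<real n + 1}. main2 t \<in> \<int> \<and> M3 t \<in> \<int>" if n: "n \<in> S" for n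
      proof -
        have "\<exists>t\<in>{real n<..<real n + 1}. main2 t \<in> \<int> \<and> divisor_main_term 3 t \<in> \<int>"
          using local_neg[OF n] none sub[OF n] by blast
        then show ?thesis using M3 S(3)[OF n] by force
      qed
      then obtain t where t: "\<And>n. n \<in> S \<Longrightarrow> t n \<in> {real n<..<real n + 1} \<and> main2 (t n) \<in> \<int> \<and> M3 (t n) \<in> \<int>"
        by metis
      \<comment> \<open>Different \<open>n\<close> give different \<open>t n\<close>, which is more than the bound \<open>k\<close> on common integer values allows.\<close>
      have "inj_on t S"
      proof (rule inj_onI)
        fix m n assume mn: "m \<in> S" "n \<in> S" "t m = t n"
        then have "real m < real n + 1" "real n < real m + 1" using t[of m] t[of n] by auto
        then show "m = n" by linarith
      qed
      then have "card (t ` S) = Suc k" using S(2) by (simp add: card_image)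
      moreover have "card (t ` S) < k"
      proof -
        have "t ` S \<subseteq> {T..T + T powr (9 / 10)}" using t sub unfolding I_def by blast
        moreover have "\<forall>x\<in>t ` S. main2 x \<in> \<int> \<and> M3 x \<in> \<int>" using t by simp
        ultimately show ?thesis using elim(1) S(1) by (simp only: finite_imageI)
      qed
      ultimately show False by simp
    qed
    have "T powr (9 / 10) \<le> T powr (139 / 144 + \<epsilon>)"
      using assms elim(4) by (intro powr_mono) auto
    then have "I \<subseteq> {T..T + T powr (139 / 144 + \<epsilon>)}" by (auto simp: I_def)
    with pos neg elim(4) show ?case unfolding changes_sign_on_def f_def by blast
  qed
  then obtain T0 where "\<And>T. T \<ge> T0 \<Longrightarrow> T \<ge> 1 \<and> changes_sign_on (\<lambda>x. divisor_error 2 x * divisor_error 3 x)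
             {T..T + T powr (139 / 144 + \<epsilon>)}"
    unfolding eventually_at_top_linorder by blast
  then show ?thesis by (intro exI[of _ "max 1 T0"]) simp
qed

end
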